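(* Let $K$ be a closed convex subset of $\mathbf{R}^d$ with $\dim(K)\in\{1,\ldots,d-1\}$, let $\Omega=\mathbf{R}^d\setminus K$, and let $d_H=\dim(K)$ be the Hausdorff dimension of $\Gamma=\partial\Omega$. Let $c_\Omega=c\circ d_\Gamma$ where $c(s)=s^\delta(1+s)^{\delta'-\delta}$ for $s>0$, with $\delta,\delta'\geq0$, and let $p\in[1,\infty)$ with $d-d_H+(\delta\wedge\delta')-p>0$. Then the optimal constant $$\mu_p(\Omega)=\inf\Big\{\int_\Omega c_\Omega\,|\nabla\varphi|^p\Big/\int_\Omega c_\Omega\,d_\Gamma^{\,-p}\,|\varphi|^p:\ \varphi\in C_c^1(\Omega),\ \varphi\neq0\Big\}$$ in the weighted Hardy inequality on $\Omega$ satisfies $\mu_p(\Omega)\leq\big((d-d_H+\delta-p)/p\big)^p$. In particular, if $\delta\leq\delta'$ then $\mu_p(\Omega)=\big((d-d_H+\delta-p)/p\big)^p$.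
   Context: All functions are real-valued. $\dim(K)$ is the dimension of the affine hull of $K$. $d_\Gamma(x)=\inf_{y\in\mathbf{R}^d\setminus\Omega}|x-y|$ for $x\in\Omega$ is the Euclidean distance to $\Gamma$. $|\nabla\varphi|=(\sum_{k=1}^d|\partial_k\varphi|^2)^{1/2}$; $\delta\wedge\delta'=\min(\delta,\delta')$. *)

theory Defs
  imports "HOL-Analysis.Analysis"
begin

definition hausdorff_premeasure :: "real \<Rightarrow> real \<Rightarrow> 'a::metric_space set \<Rightarrow> ennreal" where
  "hausdorff_premeasure s \<epsilon> A =
     (INF U \<in> {U :: nat \<Rightarrow> 'a set. A \<subseteq> (\<Union>i. U i) \<and> (\<forall>i. bounded (U i) \<and> diameter (U i) \<le> \<epsilon>)}.
        \<Sum>i. ennreal (diameter (U i) powr s))"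

definition hausdorff_measure :: "real \<Rightarrow> 'a::metric_space set \<Rightarrow> ennreal" where
  "hausdorff_measure s A = (SUP \<epsilon> \<in> {0<..}. hausdorff_premeasure s \<epsilon> A)"

text \<open>The exponent \<open>s = 0\<close> is left out because \<open>0 powr 0 = 0\<close>; this does not change the
  infimum. In a Euclidean space the set below contains every \<open>s > DIM('a)\<close>, so the real
  infimum is not one of an empty set.\<close>

definition hausdorff_dim :: "'a::euclidean_space set \<Rightarrow> real" where
  "hausdorff_dim A = Inf {s. 0 < s \<and> hausdorff_measure s A = 0}"

definition partial_deriv :: "'a::euclidean_space \<Rightarrow> ('a \<Rightarrow> real) \<Rightarrow> 'a \<Rightarrow> real" where
  "partial_deriv k \<phi> x = frechet_derivative \<phi> (at x) k"

definition grad_norm :: "('a::euclidean_space \<Rightarrow> real) \<Rightarrow> 'a \<Rightarrow> real" where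
  "grad_norm \<phi> x = sqrt (\<Sum>k\<in>Basis. \<bar>partial_deriv k \<phi> x\<bar>\<^sup>2)"

text \<open>A function in $C_c^1(\Omega)$ is identified with its extension by zero to the whole space.\<close>

definition C1_compact_support :: "'a::euclidean_space set \<Rightarrow> ('a \<Rightarrow> real) set" where
  "C1_compact_support \<Omega> =
     {\<phi>. (\<forall>x. \<phi> differentiable (at x)) \<and>
         (\<forall>k\<in>Basis. continuous_on UNIV (partial_deriv k \<phi>)) \<and>
         compact (closure {x. \<phi> x \<noteq> 0}) \<and> closure {x. \<phi> x \<noteq> 0} \<subseteq> \<Omega>}"

definition bdist :: "'a::euclidean_space set \<Rightarrow> 'a \<Rightarrow> real" where
  "bdist \<Omega> x = infdist x (- \<Omega>)"

definition weight :: "real \<Rightarrow> real \<Rightarrow> real \<Rightarrow> real" where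
  "weight \<delta> \<delta>' s = s powr \<delta> * (1 + s) powr (\<delta>' - \<delta>)"

definition hardy_constant :: "real \<Rightarrow> (real \<Rightarrow> real) \<Rightarrow> 'a::euclidean_space set \<Rightarrow> real" where
  "hardy_constant p c \<Omega> =
     (INF \<phi> \<in> {\<phi> \<in> C1_compact_support \<Omega>. \<phi> \<noteq> (\<lambda>x. 0)}.
        (LINT x:\<Omega>|lborel. c (bdist \<Omega> x) * grad_norm \<phi> x powr p) /
        (LINT x:\<Omega>|lborel. c (bdist \<Omega> x) * bdist \<Omega> x powr (- p) * \<bar>\<phi> x\<bar> powr p))"

end

theory Submission
  imports Defs
begin

text \<open>
  Let \<open>k\<close> be the dimension of \<open>K\<close>, \<open>m\<close> its codimension, \<open>d(x)\<close> the distance of \<open>x\<close> from \<open>K\<close>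
  and \<open>\<alpha> = (m + \<delta> - p) / p\<close>.  Since \<open>K\<close> has empty interior, the boundary of its complement is
  \<open>K\<close> itself.

  \<^bold>\<open>Dimension.\<close>  \<open>K\<close> lies in a flat of dimension \<open>k\<close>, which is exhausted by cubes that are cheaply
  covered by grids, and it contains a relatively open piece of that flat.  Thickening a cover of this
  piece by unit cubes in the normal directions turns sums of \<open>k\<close>-th powers of diameters into Lebesgue
  measures of boxes, so such sums cannot be small.

  \<^bold>\<open>Lower bound for the constant.\<close>  The square of the distance has gradient \<open>2 (x - \<pi> x)\<close>, where
  \<open>\<pi>\<close> is the nearest point projection.  This projection is nonexpansive and takes its values in a
  \<open>k\<close>-dimensional flat, so the divergence of \<open>x - \<pi> x\<close> is at least \<open>m\<close> in the weak sense
  (\<open>weak_laplacian_infdist_sq\<close>).  Testing this with \<open>c(d) d powr (- p) * \<bar>\<phi>\<bar> powr p\<close>, and using that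
  \<open>s c'(s) \<ge> \<delta> c(s)\<close> when \<open>\<delta> \<le> \<delta>'\<close>, bounds \<open>p \<alpha>\<close> times the denominator by an integral containing
  \<open>\<bar>\<phi>\<bar> powr (p - 1)\<close> and the gradient (\<open>first_order_hardy\<close>); a pointwise use of Young's inequality
  then gives \<open>hardy_inequality\<close>.

  \<^bold>\<open>Upper bound.\<close>  Near a relatively interior point, \<open>d\<close> is the distance to the flat.  For the power
  \<open>d powr (- \<alpha>)\<close> both integrands are multiples of \<open>d powr (- m)\<close>, up to a factor that is bounded
  above and below.  This is the borderline of integrability: by scaling in the normal directions,
  every shell \<open>exp (- j - 1) < d \<le> exp (- j)\<close> carries a comparable amount.  Cutting the power off
  smoothly on a range of about \<open>n\<close> shells, slowly in \<open>ln d\<close>, changes the gradient by a relative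
  error of order \<open>1 / n\<close> only, so the quotients approach \<open>\<alpha> powr p\<close> (\<open>near_optimal_trial\<close>).  The
  factor \<open>(1 + d) powr (\<delta>' - \<delta>)\<close> occurs in both integrals, and in the limit only its boundedness
  matters.
\<close>

section \<open>Orthonormal frames adapted to a convex set\<close>

text \<open>The frame is indexed by the standard basis, so that passing to frame coordinates is a
  rotation of the space itself and Lebesgue measure can be compared on both sides.\<close>

definition orthonormal_frame :: "('a::euclidean_space \<Rightarrow> 'a) \<Rightarrow> bool" where
  "orthonormal_frame f \<longleftrightarrow> (\<forall>i\<in>Basis. \<forall>j\<in>Basis. f i \<bullet> f j = (if i = j then 1 else 0))"

definition frame_map :: "('a::euclidean_space \<Rightarrow> 'a) \<Rightarrow> 'a \<Rightarrow> 'a" where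
  "frame_map f z = (\<Sum>b\<in>Basis. (z \<bullet> b) *\<^sub>R f b)"

definition frame_coords :: "('a::euclidean_space \<Rightarrow> 'a) \<Rightarrow> 'a \<Rightarrow> 'a" where
  "frame_coords f x = (\<Sum>b\<in>Basis. (x \<bullet> f b) *\<^sub>R b)"

lemma frame_coords_inner [simp]: "b \<in> Basis \<Longrightarrow> frame_coords f x \<bullet> b = x \<bullet> f b"
  by (simp add: frame_coords_def inner_sum_left inner_Basis if_distrib cong: if_cong)

lemma inner_sum_Basis_subset:
  assumes "S \<subseteq> Basis" "b \<in> Basis"
  shows "(\<Sum>i\<in>S. g i *\<^sub>R i) \<bullet> b = (if b \<in> S then g b else 0)"
proof -
  have "(\<Sum>i\<in>S. g i *\<^sub>R i) \<bullet> b = (\<Sum>i\<in>S. if i = b then g b else 0)"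
    unfolding inner_sum_left using assms by (intro sum.cong) (auto simp: inner_Basis)
  then show ?thesis
    using finite_subset[OF assms(1)] by simp
qed

lemma linear_frame_map: "linear (frame_map f)"
  unfolding frame_map_def by (intro linearI) (simp_all add: inner_simps scaleR_left_distrib
      sum.distrib scaleR_sum_right)

lemma frame_map_inner:
  assumes "orthonormal_frame f" "b \<in> Basis"
  shows "frame_map f z \<bullet> f b = z \<bullet> b"
proof -
  have "frame_map f z \<bullet> f b = (\<Sum>i\<in>Basis. if i = b then z \<bullet> i else 0)"
    unfolding frame_map_def inner_sum_left inner_scaleR_left
    using assms by (intro sum.cong) (auto simp: orthonormal_frame_def)
  then show ?thesis
    using assms by simp
qed

lemma frame_coords_map:
  assumes "orthonormal_frame f"
  shows "frame_coords f (frame_map f z) = z"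
  by (rule euclidean_eqI) (simp add: frame_map_inner assms)

lemma frame_map_coords:
  assumes "orthonormal_frame f"
  shows "frame_map f (frame_coords f x) = x"
proof -
  have "inj (frame_map f)"
    by (metis assms frame_coords_map inj_on_inverseI)
  then have "surj (frame_map f)"
    using linear_injective_imp_surjective linear_frame_map by blast
  then obtain z where "x = frame_map f z"
    by blast
  then show ?thesis
    using frame_coords_map[OF assms] by simp
qed

lemma frame_expansion:
  assumes "orthonormal_frame f"
  shows "(\<Sum>b\<in>Basis. (x \<bullet> f b) *\<^sub>R f b) = x"
  using frame_map_coords[OF assms, of x] by (simp add: frame_map_def)

lemma frame_inner:
  assumes "orthonormal_frame f"
  shows "x \<bullet> z = (\<Sum>b\<in>Basis. (x \<bullet> f b) * (z \<bullet> f b))"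
proof -
  have "x \<bullet> z = (\<Sum>b\<in>Basis. (x \<bullet> f b) *\<^sub>R f b) \<bullet> z"
    by (simp only: frame_expansion[OF assms])
  also have "\<dots> = (\<Sum>b\<in>Basis. (x \<bullet> f b) * (z \<bullet> f b))"
    unfolding inner_sum_left by (simp add: inner_commute[of z])
  finally show ?thesis .
qed

lemma norm_frame_map:
  assumes "orthonormal_frame f"
  shows "norm (frame_map f z) = norm z"
proof -
  have "(norm (frame_map f z))\<^sup>2 = (\<Sum>b\<in>Basis. (z \<bullet> b) * (z \<bullet> b))"
    unfolding power2_norm_eq_inner
    by (subst frame_inner[OF assms]) (simp add: frame_map_inner[OF assms])
  also have "\<dots> = (norm z)\<^sup>2"
    unfolding power2_norm_eq_inner by (rule euclidean_inner[symmetric])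
  finally show ?thesis
    by simp
qed

text \<open>A basis of the orthogonal complement of a subspace completes an orthonormal basis of the
  subspace; the standard basis only serves as an index set of the right size.\<close>

lemma subspace_frame:
  fixes V :: "'a::euclidean_space set"
  assumes "subspace V"
  obtains f S where "orthonormal_frame f" "S \<subseteq> Basis" "card S = dim V"
    "\<And>x. x \<in> V \<longleftrightarrow> (\<forall>b\<in>Basis - S. x \<bullet> f b = 0)"
proof -
  define W where "W = {y \<in> UNIV. \<forall>x\<in>V. orthogonal x y}"
  have W: "subspace W"
    unfolding W_def orthogonal_def
    by (auto simp: subspace_def inner_simps)
  have dims: "dim W + dim V = DIM('a)"
    unfolding W_def using dim_subspace_orthogonal_to_vectors[of V UNIV] assms by simp
  obtain A where A: "A \<subseteq> V" "pairwise orthogonal A" "\<And>x. x \<in> A \<Longrightarrow> norm x = 1"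
      "independent A" "card A = dim V" "span A = V"
    using orthonormal_basis_subspace[OF assms] by blast
  obtain C where C: "C \<subseteq> W" "pairwise orthogonal C" "\<And>x. x \<in> C \<Longrightarrow> norm x = 1"
      "independent C" "card C = dim W" "span C = W"
    using orthonormal_basis_subspace[OF W] by blast
  have fin: "finite A" "finite C"
    using A(4) C(4) independent_imp_finite by auto
  have AC: "orthogonal a c" if "a \<in> A" "c \<in> C" for a c
    using that A(1) C(1) by (auto simp: W_def)
  obtain S :: "'a set" where S: "S \<subseteq> Basis" "card S = dim V"
    using obtain_subset_with_card_n[of "dim V" "Basis :: 'a set"] dims by auto
  have finS: "finite S"
    using S(1) finite_Basis by (rule finite_subset)
  have cardS': "card (Basis - S) = dim W"
    using S dims finS by (simp add: card_Diff_subset)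
  obtain g where g: "bij_betw g S A"
    using finite_same_card_bij[OF finS fin(1)] S A by auto
  obtain h where h: "bij_betw h (Basis - S) C"
    using finite_same_card_bij[of "Basis - S" C] fin cardS' C by auto
  define f where "f b = (if b \<in> S then g b else h b)" for b
  have fS: "f b \<in> A" if "b \<in> S" for b
    using that g by (auto simp: f_def bij_betw_def)
  have fS': "f b \<in> C" if "b \<in> Basis - S" for b
    using that h by (auto simp: f_def bij_betw_def)
  have gA: "g b \<in> A" if "b \<in> S" for b
    using fS[OF that] that by (simp add: f_def)
  have hC: "h b \<in> C" if "b \<in> Basis - S" for b
    using fS'[OF that] that by (simp add: f_def)
  have injg: "g i = g j \<longleftrightarrow> i = j" if "i \<in> S" "j \<in> S" for i j
    using g that by (meson bij_betw_def inj_on_eq_iff)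
  have injh: "h i = h j \<longleftrightarrow> i = j" if "i \<in> Basis - S" "j \<in> Basis - S" for i j
    using h that by (meson bij_betw_def inj_on_eq_iff)
  have gg: "g i \<bullet> g j = (if i = j then 1 else 0)" if "i \<in> S" "j \<in> S" for i j
  proof (cases "i = j")
    case True
    then show ?thesis
      using A(3)[OF gA[OF that(1)]] by (simp add: norm_eq_1)
  next
    case False
    then have "orthogonal (g i) (g j)"
      using A(2) gA[OF that(1)] gA[OF that(2)] injg[OF that] by (simp add: pairwise_def)
    then show ?thesis
      using False by (simp add: orthogonal_def)
  qed
  have hh: "h i \<bullet> h j = (if i = j then 1 else 0)"
    if "i \<in> Basis - S" "j \<in> Basis - S" for i j
  proof (cases "i = j")
    case True
    then show ?thesis
      using C(3)[OF hC[OF that(1)]] by (simp add: norm_eq_1)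
  next
    case False
    then have "orthogonal (h i) (h j)"
      using C(2) hC[OF that(1)] hC[OF that(2)] injh[OF that] by (simp add: pairwise_def)
    then show ?thesis
      using False by (simp add: orthogonal_def)
  qed
  have gh: "g i \<bullet> h j = 0" "h j \<bullet> g i = 0" if "i \<in> S" "j \<in> Basis - S" for i j
    using AC[OF gA[OF that(1)] hC[OF that(2)]] by (simp_all add: orthogonal_def inner_commute)
  have "f i \<bullet> f j = (if i = j then 1 else 0)" if "i \<in> Basis" "j \<in> Basis" for i j
    using that gg[of i j] hh[of i j] gh[of i j] gh[of j i] by (auto simp: f_def)
  then have frame: "orthonormal_frame f"
    by (simp add: orthonormal_frame_def)
  have "x \<in> V \<longleftrightarrow> (\<forall>b\<in>Basis - S. x \<bullet> f b = 0)" for x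
  proof
    assume "x \<in> V"
    then show "\<forall>b\<in>Basis - S. x \<bullet> f b = 0"
      using fS' C(1) by (force simp: W_def orthogonal_def)
  next
    assume *: "\<forall>b\<in>Basis - S. x \<bullet> f b = 0"
    have "x = (\<Sum>b\<in>Basis. (x \<bullet> f b) *\<^sub>R f b)"
      by (simp add: frame_expansion[OF frame])
    also have "\<dots> = (\<Sum>b\<in>S. (x \<bullet> f b) *\<^sub>R f b)"
      using S * by (intro sum.mono_neutral_right) auto
    also have "\<dots> \<in> V"
      using fS A(1) assms by (intro subspace_sum subspace_scale) auto
    finally show "x \<in> V" .
  qed
  with frame S show ?thesis
    using that by blast
qed

text \<open>The standing situation: \<open>K\<close> lies in the flat through \<open>y\<close> spanned by the directions \<open>f b\<close> with
  \<open>b \<in> S\<close>, and contains the points of that flat within distance \<open>\<rho>\<close> of \<open>y\<close>.  Thus \<open>y\<close> is a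
  relatively interior point and \<open>card S\<close> is the dimension of \<open>K\<close>.\<close>

locale convex_in_flat =
  fixes K :: "'a::euclidean_space set" and f :: "'a \<Rightarrow> 'a" and S :: "'a set"
    and y :: 'a and \<rho> :: real
  assumes closed_K: "closed K" and convex_K: "convex K"
    and frame: "orthonormal_frame f" and S_Basis: "S \<subseteq> Basis"
    and y_K: "y \<in> K" and \<rho>_pos: "\<rho> > 0"
    and K_flat: "\<And>x b. x \<in> K \<Longrightarrow> b \<in> Basis - S \<Longrightarrow> (x - y) \<bullet> f b = 0"
    and flat_ball_K: "\<And>x. dist y x \<le> \<rho> \<Longrightarrow> (\<And>b. b \<in> Basis - S \<Longrightarrow> (x - y) \<bullet> f b = 0) \<Longrightarrow> x \<in> K"

lemma convex_in_flat_exists: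
  fixes K :: "'a::euclidean_space set"
  assumes "closed K" "convex K" "aff_dim K = int k"
  obtains f S y \<rho> where "convex_in_flat K f S y \<rho>" "card S = k"
proof -
  have "K \<noteq> {}"
    using assms(3) by auto
  then have "rel_interior K \<noteq> {}"
    using assms(2) rel_interior_eq_empty by blast
  then obtain y where "y \<in> rel_interior K"
    by blast
  then obtain \<rho> where y: "y \<in> K" and \<rho>: "\<rho> > 0" "cball y \<rho> \<inter> affine hull K \<subseteq> K"
    by (auto simp: mem_rel_interior_cball)
  define V where "V = (\<lambda>x. x - y) ` (affine hull K)"
  have yA: "y \<in> affine hull K"
    by (simp add: hull_inc y)
  have V: "subspace V"
    unfolding V_def by (rule affine_diffs_subspace_subtract) (simp_all add: yA)
  have dimV: "dim V = k"
    using aff_dim_eq_dim_subtract[of y "affine hull K"] yA assms(3)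
    by (simp add: V_def aff_dim_affine_hull)
  have mem: "x - y \<in> V \<longleftrightarrow> x \<in> affine hull K" for x
    by (auto simp: V_def)
  obtain f S where f: "orthonormal_frame f" "S \<subseteq> Basis" "card S = dim V"
      "\<And>x. x \<in> V \<longleftrightarrow> (\<forall>b\<in>Basis - S. x \<bullet> f b = 0)"
    using subspace_frame[OF V] by blast
  have "convex_in_flat K f S y \<rho>"
  proof
    show "(x - y) \<bullet> f b = 0" if "x \<in> K" "b \<in> Basis - S" for x b
      using that f(4)[of "x - y"] mem[of x] by (simp add: hull_inc)
    show "x \<in> K" if "dist y x \<le> \<rho>" "\<And>b. b \<in> Basis - S \<Longrightarrow> (x - y) \<bullet> f b = 0" for x
      using that f(4)[of "x - y"] mem[of x] \<rho>(2) by auto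
  qed (use assms f y \<rho> in auto)
  then show ?thesis
    using that f(3) dimV by blast
qed

section \<open>Hausdorff dimension\<close>

lemma hausdorff_premeasure_mono:
  "A \<subseteq> B \<Longrightarrow> hausdorff_premeasure s \<epsilon> A \<le> hausdorff_premeasure s \<epsilon> B"
  unfolding hausdorff_premeasure_def by (rule INF_superset_mono) auto

lemma hausdorff_measure_eq_0_iff:
  "hausdorff_measure s A = 0 \<longleftrightarrow> (\<forall>\<epsilon>>0. hausdorff_premeasure s \<epsilon> A = 0)"
proof -
  have "hausdorff_measure s A = 0 \<longleftrightarrow> hausdorff_measure s A \<le> 0"
    by simp
  also have "\<dots> \<longleftrightarrow> (\<forall>\<epsilon>>0. hausdorff_premeasure s \<epsilon> A \<le> 0)"
    unfolding hausdorff_measure_def SUP_le_iff by auto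
  finally show ?thesis
    by simp
qed

lemma hausdorff_premeasure_lessD:
  assumes "hausdorff_premeasure s \<epsilon> A < c"
  obtains U :: "nat \<Rightarrow> 'a::metric_space set" where "A \<subseteq> (\<Union>i. U i)"
    "\<And>i. bounded (U i)" "\<And>i. diameter (U i) \<le> \<epsilon>" "(\<Sum>i. ennreal (diameter (U i) powr s)) < c"
  using assms unfolding hausdorff_premeasure_def INF_less_iff by auto

text \<open>The \<open>n\<close>-th piece is covered at cost \<open>e / 2 ^ (n + 1)\<close>, and the covers are merged along the
  pairing of the natural numbers.\<close>

lemma hausdorff_premeasure_Union_eq_0:
  fixes A :: "nat \<Rightarrow> 'a::metric_space set"
  assumes "\<And>n. hausdorff_premeasure s \<epsilon> (A n) = 0"
  shows "hausdorff_premeasure s \<epsilon> (\<Union>n. A n) = 0"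
proof -
  have "hausdorff_premeasure s \<epsilon> (\<Union>n. A n) \<le> ennreal e" if e: "e > 0" for e
  proof -
    have "\<exists>U. A n \<subseteq> (\<Union>i. U i) \<and> (\<forall>i. bounded (U i) \<and> diameter (U i) \<le> \<epsilon>) \<and>
        (\<Sum>i. ennreal (diameter (U i) powr s)) \<le> ennreal (e * (1/2) ^ Suc n)" for n
    proof -
      have "hausdorff_premeasure s \<epsilon> (A n) < ennreal (e * (1/2) ^ Suc n)"
        using assms e by (simp add: ennreal_zero_less_mult_iff)
      then show ?thesis
        by (elim hausdorff_premeasure_lessD) (metis less_imp_le)
    qed
    then obtain U where U: "\<And>n. A n \<subseteq> (\<Union>i. U n i)" "\<And>n i. bounded (U n i)"
      "\<And>n i. diameter (U n i) \<le> \<epsilon>"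
      "\<And>n. (\<Sum>i. ennreal (diameter (U n i) powr s)) \<le> ennreal (e * (1/2) ^ Suc n)"
      by metis
    define W where "W i = (case prod_decode i of (n, j) \<Rightarrow> U n j)" for i
    have cover: "(\<Union>n. A n) \<subseteq> (\<Union>i. W i)"
    proof
      fix x assume "x \<in> (\<Union>n. A n)"
      then obtain n j where "x \<in> U n j"
        using U(1) by blast
      then have "x \<in> W (prod_encode (n, j))"
        by (simp add: W_def)
      then show "x \<in> (\<Union>i. W i)"
        by blast
    qed
    have W: "bounded (W i) \<and> diameter (W i) \<le> \<epsilon>" for i
      by (cases "prod_decode i") (simp add: W_def U)
    have "hausdorff_premeasure s \<epsilon> (\<Union>n. A n) \<le> (\<Sum>i. ennreal (diameter (W i) powr s))"
      unfolding hausdorff_premeasure_def by (rule INF_lower) (use cover W in auto)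
    also have "\<dots> = (\<Sum>i. (case prod_decode i of (n, j) \<Rightarrow> ennreal (diameter (U n j) powr s)))"
      by (intro arg_cong[where f = suminf] ext) (simp add: W_def split: prod.split)
    also have "\<dots> = (\<Sum>n. \<Sum>j. ennreal (diameter (U n j) powr s))"
      by (rule suminf_ennreal_2dimen) simp
    also have "\<dots> \<le> (\<Sum>n. ennreal (e * (1/2) ^ Suc n))"
      by (intro suminf_le U(4)) auto
    also have "\<dots> = ennreal (\<Sum>n. e * (1/2) ^ Suc n)"
      using e power_half_series[THEN sums_mult, of e]
      by (intro suminf_ennreal2) (auto simp: sums_iff)
    also have "(\<Sum>n. e * (1/2::real) ^ Suc n) = e"
      using power_half_series[THEN sums_mult, of e] by (simp add: sums_iff)
    finally show ?thesis .
  qed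
  then have "hausdorff_premeasure s \<epsilon> (\<Union>n. A n) \<le> 0"
    by - (rule ennreal_le_epsilon, simp)
  then show ?thesis
    by simp
qed

text \<open>A finite cover is padded with empty sets, which cost nothing because \<open>0 powr s = 0\<close>.\<close>

lemma hausdorff_premeasure_finite_cover:
  fixes U :: "'i \<Rightarrow> 'a::metric_space set"
  assumes I: "finite I" "A \<subseteq> (\<Union>i\<in>I. U i)"
    and U: "\<And>i. i \<in> I \<Longrightarrow> bounded (U i)" "\<And>i. i \<in> I \<Longrightarrow> diameter (U i) \<le> D"
    and D: "0 \<le> D" "D \<le> \<epsilon>" and s: "s \<ge> 0"
  shows "hausdorff_premeasure s \<epsilon> A \<le> ennreal (real (card I) * D powr s)"
proof -
  obtain g where g: "bij_betw g {..<card I} I"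
    using bij_betw_from_nat_into_finite[OF I(1)] by blast
  define W where "W i = (if i < card I then U (g i) else {})" for i
  have gI: "g i \<in> I" if "i < card I" for i
    using g that by (auto simp: bij_betw_def)
  have "(\<Union>i\<in>I. U i) = (\<Union>i. W i)"
  proof -
    have "(\<Union>i\<in>I. U i) = (\<Union>i<card I. U (g i))"
      using g by (simp add: bij_betw_def flip: image_image[of U g])
    also have "\<dots> = (\<Union>i. W i)"
      by (auto simp: W_def split: if_splits)
    finally show ?thesis .
  qed
  with I(2) have cover: "A \<subseteq> (\<Union>i. W i)"
    by simp
  have W: "bounded (W i) \<and> diameter (W i) \<le> \<epsilon>" for i
    using U[OF gI, of i] D by (auto simp: W_def)
  have "hausdorff_premeasure s \<epsilon> A \<le> (\<Sum>i. ennreal (diameter (W i) powr s))"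
    unfolding hausdorff_premeasure_def by (rule INF_lower) (use cover W in auto)
  also have "\<dots> = (\<Sum>i<card I. ennreal (diameter (W i) powr s))"
    by (rule suminf_finite) (auto simp: W_def)
  also have "\<dots> \<le> (\<Sum>i<card I. ennreal (D powr s))"
    using U gI s by (intro sum_mono ennreal_leI powr_mono2) (auto simp: W_def diameter_ge_0)
  also have "\<dots> = ennreal (real (card I) * D powr s)"
    by (simp add: ennreal_mult' ennreal_of_nat_eq_real_of_nat)
  finally show ?thesis .
qed

text \<open>A grid of \<open>m ^ k\<close> cells, each of diameter of order \<open>1 / m\<close>, costs of the order of
  \<open>m powr (k - s)\<close>, which tends to \<open>0\<close>.\<close>

lemma flat_cube_hausdorff_null:
  fixes f :: "'a::euclidean_space \<Rightarrow> 'a"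
  assumes frame: "orthonormal_frame f" and S: "S \<subseteq> Basis" "card S = k"
    and R: "R > 0" and s: "s > real k" and \<epsilon>: "\<epsilon> > 0"
  shows "hausdorff_premeasure s \<epsilon> {x. (\<forall>b\<in>S. \<bar>(x - y) \<bullet> f b\<bar> < R) \<and> (\<forall>b\<in>Basis - S. (x - y) \<bullet> f b = 0)} = 0"
    (is "hausdorff_premeasure s \<epsilon> ?A = 0")
proof -
  have fin: "finite S"
    using S(1) finite_Basis by (rule finite_subset)
  define D where "D m = real k * (2 * R / real m)" for m
  \<comment> \<open>\<open>\<kappa> b\<close> tells which of the \<open>m\<close> subintervals of \<open>(- R, R)\<close> contains the coordinate of \<open>x\<close> along \<open>f b\<close>\<close>
  define U where "U m \<kappa> = {x \<in> ?A. \<forall>b\<in>S. \<kappa> b = nat \<lfloor>((x - y) \<bullet> f b + R) * real m / (2 * R)\<rfloor>}"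
    for m and \<kappa> :: "'a \<Rightarrow> nat"
  have dist_le: "dist x x' \<le> D m" if m: "m > 0" and x: "x \<in> U m \<kappa>" "x' \<in> U m \<kappa>" for m \<kappa> x x'
  proof -
    have coord: "\<bar>(x - x') \<bullet> f b\<bar> \<le> 2 * R / real m" if b: "b \<in> S" for b
    proof -
      let ?t = "\<lambda>x. ((x - y) \<bullet> f b + R) * real m / (2 * R)"
      have nonneg: "?t x \<ge> 0" "?t x' \<ge> 0"
        using x b R by (auto simp: U_def abs_less_iff intro!: divide_nonneg_pos mult_nonneg_nonneg)
      have "nat \<lfloor>?t x\<rfloor> = nat \<lfloor>?t x'\<rfloor>"
        using x b by (simp add: U_def)
      then have "\<lfloor>?t x\<rfloor> = \<lfloor>?t x'\<rfloor>"
        using nonneg by (metis zero_le_floor int_nat_eq)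
      then have "\<bar>?t x - ?t x'\<bar> \<le> 1"
        by linarith
      moreover have "?t x - ?t x' = ((x - x') \<bullet> f b) * (real m / (2 * R))"
        by (simp add: inner_simps algebra_simps flip: diff_divide_distrib)
      ultimately have "\<bar>(x - x') \<bullet> f b\<bar> * (real m / (2 * R)) \<le> 1"
        using R by (simp add: abs_mult)
      then show ?thesis
        using R m by (simp add: field_simps)
    qed
    have flat: "(x - x') \<bullet> f b = 0" if "b \<in> Basis - S" for b
      using x that by (simp add: U_def inner_simps)
    have "x - x' = (\<Sum>b\<in>Basis. ((x - x') \<bullet> f b) *\<^sub>R f b)"
      by (simp add: frame_expansion[OF frame])
    also have "\<dots> = (\<Sum>b\<in>S. ((x - x') \<bullet> f b) *\<^sub>R f b)"
      using S(1) flat by (intro sum.mono_neutral_right) auto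
    also have "norm \<dots> \<le> (\<Sum>b\<in>S. \<bar>(x - x') \<bullet> f b\<bar>)"
    proof (rule order_trans[OF norm_sum sum_mono])
      fix b assume "b \<in> S"
      then have "norm (f b) = 1"
        using frame S(1) by (auto simp: orthonormal_frame_def norm_eq_1)
      then show "norm (((x - x') \<bullet> f b) *\<^sub>R f b) \<le> \<bar>(x - x') \<bullet> f b\<bar>"
        by simp
    qed
    also have "\<dots> \<le> (\<Sum>b\<in>S. 2 * R / real m)"
      by (intro sum_mono coord)
    also have "\<dots> = D m"
      by (simp add: D_def S(2))
    finally show ?thesis
      by (simp add: dist_norm)
  qed
  have le: "hausdorff_premeasure s \<epsilon> ?A \<le> ennreal (real m ^ k * D m powr s)"
    if m: "m > 0" "D m \<le> \<epsilon>" for m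
  proof -
    let ?I = "S \<rightarrow>\<^sub>E {..<m}"
    have D0: "D m \<ge> 0"
      using R by (simp add: D_def)
    have "hausdorff_premeasure s \<epsilon> ?A \<le> ennreal (real (card ?I) * D m powr s)"
    proof (rule hausdorff_premeasure_finite_cover[where U = "U m"])
      show "finite ?I"
        using fin by (simp add: finite_PiE)
      show "?A \<subseteq> (\<Union>\<kappa>\<in>?I. U m \<kappa>)"
      proof
        fix x assume x: "x \<in> ?A"
        define \<kappa> where "\<kappa> = (\<lambda>b\<in>S. nat \<lfloor>((x - y) \<bullet> f b + R) * real m / (2 * R)\<rfloor>)"
        have "nat \<lfloor>((x - y) \<bullet> f b + R) * real m / (2 * R)\<rfloor> < m" if "b \<in> S" for b
        proof -
          have "((x - y) \<bullet> f b + R) * real m / (2 * R) < real m"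
            using x that R m by (auto simp: field_simps abs_less_iff)
          then have "\<lfloor>((x - y) \<bullet> f b + R) * real m / (2 * R)\<rfloor> < int m"
            by (simp add: floor_less_iff)
          then show ?thesis
            using m by linarith
        qed
        then have "\<kappa> \<in> ?I"
          by (auto simp: \<kappa>_def)
        moreover have "x \<in> U m \<kappa>"
          using x by (simp add: U_def \<kappa>_def)
        ultimately show "x \<in> (\<Union>\<kappa>\<in>?I. U m \<kappa>)"
          by blast
      qed
      show "bounded (U m \<kappa>)" for \<kappa>
        unfolding bounded_two_points using dist_le[OF m(1)] by blast
      show "diameter (U m \<kappa>) \<le> D m" for \<kappa>
        using dist_le[OF m(1)] D0 by (intro diameter_le) (auto simp: dist_norm)
    qed (use m s D0 in auto)
    then show ?thesis
      using fin by (simp add: card_PiE S(2))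
  qed
  have lim_D: "D \<longlonglongrightarrow> 0"
    unfolding D_def by real_asymp
  have "(\<lambda>m. (real k * (2 * R)) powr s * real m powr (real k - s)) \<longlonglongrightarrow> 0"
    using s by (intro tendsto_mult_right_zero tendsto_neg_powr filterlim_real_sequentially) auto
  moreover have "\<forall>\<^sub>F m in sequentially.
      (real k * (2 * R)) powr s * real m powr (real k - s) = real m ^ k * D m powr s"
    using eventually_gt_at_top[of 0]
  proof eventually_elim
    case (elim m)
    have "D m = (real k * (2 * R)) / real m"
      by (simp add: D_def)
    then have "D m powr s = (real k * (2 * R)) powr s / real m powr s"
      using R by (simp add: powr_divide)
    moreover have "real m ^ k = real m powr real k"
      using elim by (simp add: powr_realpow)
    ultimately show ?case
      by (simp add: powr_diff)
  qed
  ultimately have "(\<lambda>m. real m ^ k * D m powr s) \<longlonglongrightarrow> 0"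
    by (rule Lim_transform_eventually)
  then have "(\<lambda>m. ennreal (real m ^ k * D m powr s)) \<longlonglongrightarrow> ennreal 0"
    by (rule tendsto_ennrealI)
  moreover have "\<forall>\<^sub>F m in sequentially. hausdorff_premeasure s \<epsilon> ?A \<le> ennreal (real m ^ k * D m powr s)"
    using eventually_gt_at_top[of 0] order_tendstoD(2)[OF lim_D \<epsilon>]
    by eventually_elim (intro le, auto)
  ultimately have "hausdorff_premeasure s \<epsilon> ?A \<le> ennreal 0"
    by (intro tendsto_le[OF sequentially_bot _ tendsto_const]) auto
  then show ?thesis
    by simp
qed

context convex_in_flat
begin

lemma hausdorff_null_above:
  assumes "s > real (card S)"
  shows "hausdorff_measure s K = 0"
  unfolding hausdorff_measure_eq_0_iff
proof (intro allI impI)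
  fix \<epsilon> :: real assume \<epsilon>: "\<epsilon> > 0"
  define A where "A n = {x. (\<forall>b\<in>S. \<bar>(x - y) \<bullet> f b\<bar> < real (Suc n)) \<and> (\<forall>b\<in>Basis - S. (x - y) \<bullet> f b = 0)}"
    for n
  have "K \<subseteq> (\<Union>n. A n)"
  proof
    fix x assume x: "x \<in> K"
    obtain n where n: "norm (x - y) < real n"
      using reals_Archimedean2 by blast
    have "\<bar>(x - y) \<bullet> f b\<bar> < real (Suc n)" if "b \<in> S" for b
    proof -
      have "norm (f b) = 1"
        using frame S_Basis that by (auto simp: orthonormal_frame_def norm_eq_1)
      then have "\<bar>(x - y) \<bullet> f b\<bar> \<le> norm (x - y)"
        using Cauchy_Schwarz_ineq2[of "x - y" "f b"] by simp
      with n show ?thesis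
        by simp
    qed
    then show "x \<in> (\<Union>n. A n)"
      using K_flat[OF x] by (auto simp: A_def)
  qed
  moreover have "hausdorff_premeasure s \<epsilon> (\<Union>n. A n) = 0"
    unfolding A_def using assms \<epsilon>
    by (intro hausdorff_premeasure_Union_eq_0 flat_cube_hausdorff_null frame S_Basis refl) auto
  ultimately show "hausdorff_premeasure s \<epsilon> K = 0"
    using hausdorff_premeasure_mono[of K "\<Union>n. A n" s \<epsilon>] by simp
qed

text \<open>Lebesgue measure on the whole space takes the place of a measure on the flat.  Thickened by a unit cube in the normal directions, a covering
  set of diameter \<open>t\<close> fits into a box of Lebesgue measure at most \<open>2 ^ DIM('a) * t ^ card S\<close>.  Since
  these boxes cover a fixed box, the sum of \<open>t ^ card S\<close> is bounded below, and for \<open>t \<le> 1\<close> so is the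
  sum of the larger numbers \<open>t powr s\<close>.\<close>

lemma not_hausdorff_null_below:
  assumes s: "0 < s" "s \<le> real (card S)"
  shows "hausdorff_measure s K \<noteq> 0"
proof
  assume null: "hausdorff_measure s K = 0"
  \<comment> \<open>chosen so that points with tangential coordinates at most \<open>r\<close> have norm at most \<open>\<rho>\<close>\<close>
  define r where "r = \<rho> / real DIM('a)"
  have r: "r > 0"
    using \<rho>_pos by (simp add: r_def)
  \<comment> \<open>half the side lengths of a box: \<open>t\<close> along the flat and \<open>1\<close> across it\<close>
  define h where "h t = (\<Sum>b\<in>Basis. (if b \<in> S then t else 1) *\<^sub>R b)" for t :: real
  have h_inner: "h t \<bullet> b = (if b \<in> S then t else 1)" if "b \<in> Basis" for t b
    using that by (simp add: h_def)
  have content: "emeasure lborel (cbox (a - h t) (a + h t)) = ennreal (2 ^ DIM('a) * t ^ card S)"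
    if t: "t \<ge> 0" for t a
  proof -
    have "emeasure lborel (cbox (a - h t) (a + h t)) = ennreal (\<Prod>b\<in>Basis. ((a + h t) - (a - h t)) \<bullet> b)"
      using t by (intro emeasure_lborel_cbox) (auto simp: inner_simps h_inner)
    also have "(\<Prod>b\<in>Basis. ((a + h t) - (a - h t)) \<bullet> b) = (\<Prod>b\<in>(Basis::'a set). 2 * (if b \<in> S then t else 1))"
      by (intro prod.cong) (auto simp: inner_simps h_inner)
    also have "\<dots> = 2 ^ DIM('a) * (\<Prod>b\<in>(Basis::'a set). if b \<in> S then t else 1)"
      by (simp add: prod.distrib)
    also have "(\<Prod>b\<in>(Basis::'a set). if b \<in> S then t else 1) = t ^ card S"
      using S_Basis by (simp add: prod.If_cases Int_absorb1)
    finally show ?thesis .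
  qed
  have "hausdorff_premeasure s 1 K < ennreal (r ^ card S)"
    using null r unfolding hausdorff_measure_eq_0_iff by simp
  then obtain U where U: "K \<subseteq> (\<Union>i. U i)" "\<And>i. bounded (U i)" "\<And>i. diameter (U i) \<le> 1"
    "(\<Sum>i. ennreal (diameter (U i) powr s)) < ennreal (r ^ card S)"
    using hausdorff_premeasure_lessD by blast
  \<comment> \<open>only tangential coordinates are kept, because a covering set may also contain points off the flat\<close>
  define c where "c i = (\<Sum>b\<in>S. (((SOME p. p \<in> U i) - y) \<bullet> f b) *\<^sub>R b)" for i
  have c_inner: "c i \<bullet> b = (if b \<in> S then ((SOME p. p \<in> U i) - y) \<bullet> f b else 0)"
    if "b \<in> Basis" for i b
    unfolding c_def by (rule inner_sum_Basis_subset[OF S_Basis that])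
  define B where "B i = cbox (c i - h (diameter (U i))) (c i + h (diameter (U i)))" for i
  have "cbox (0 - h r) (0 + h r) \<subseteq> (\<Union>i. B i)"
  proof
    fix z assume z: "z \<in> cbox (0 - h r) (0 + h r)"
    have zS: "\<bar>z \<bullet> b\<bar> \<le> r" if "b \<in> S" for b
      using z that S_Basis by (force simp: mem_box inner_simps h_inner abs_le_iff)
    have zS': "\<bar>z \<bullet> b\<bar> \<le> 1" if "b \<in> Basis - S" for b
      using z that by (force simp: mem_box inner_simps h_inner abs_le_iff)
    define z' where "z' = (\<Sum>b\<in>S. (z \<bullet> b) *\<^sub>R b)"
    have z'_inner: "z' \<bullet> b = (if b \<in> S then z \<bullet> b else 0)" if "b \<in> Basis" for b
      unfolding z'_def by (rule inner_sum_Basis_subset[OF S_Basis that])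
    have "norm z' \<le> (\<Sum>b\<in>Basis. \<bar>z' \<bullet> b\<bar>)"
      by (rule norm_le_l1)
    also have "\<dots> \<le> (\<Sum>b\<in>(Basis::'a set). r)"
      using r zS by (intro sum_mono) (auto simp: z'_inner)
    also have "\<dots> = \<rho>"
      by (simp add: r_def)
    finally have "y + frame_map f z' \<in> K"
      by (intro flat_ball_K) (auto simp: dist_norm norm_frame_map[OF frame] frame_map_inner[OF frame] z'_inner)
    then obtain i where i: "y + frame_map f z' \<in> U i"
      using U(1) by blast
    define p where "p = (SOME p. p \<in> U i)"
    have p: "p \<in> U i"
      unfolding p_def using i by (metis someI)
    have "\<bar>(z - c i) \<bullet> b\<bar> \<le> diameter (U i)" if b: "b \<in> S" for b
    proof -
      have bB: "b \<in> Basis"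
        using b S_Basis by blast
      have "(z - c i) \<bullet> b = ((y + frame_map f z') - p) \<bullet> f b"
        using b bB by (simp add: c_inner p_def inner_simps frame_map_inner[OF frame] z'_inner)
      also have "\<bar>\<dots>\<bar> \<le> norm ((y + frame_map f z') - p) * norm (f b)"
        by (rule Cauchy_Schwarz_ineq2)
      also have "norm (f b) = 1"
        using frame bB by (simp add: orthonormal_frame_def norm_eq_1)
      also have "norm ((y + frame_map f z') - p) * 1 \<le> diameter (U i)"
        using diameter_bounded_bound[OF U(2) i p] by (simp add: dist_norm)
      finally show ?thesis .
    qed
    moreover have "\<bar>(z - c i) \<bullet> b\<bar> \<le> 1" if b: "b \<in> Basis - S" for b
      using zS'[OF b] b by (simp add: inner_simps c_inner)
    ultimately have "z \<in> B i"
      unfolding B_def mem_box by (force simp: inner_simps h_inner abs_le_iff)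
    then show "z \<in> (\<Union>i. B i)"
      by blast
  qed
  then have "emeasure lborel (cbox (0 - h r) (0 + h r)) \<le> emeasure lborel (\<Union>i. B i)"
    by (intro emeasure_mono) (auto simp: B_def)
  also have "\<dots> \<le> (\<Sum>i. emeasure lborel (B i))"
    by (rule emeasure_subadditive_countably) (auto simp: B_def)
  also have "\<dots> \<le> (\<Sum>i. ennreal (2 ^ DIM('a)) * ennreal (diameter (U i) powr s))"
  proof (rule suminf_le)
    fix i
    have D: "0 \<le> diameter (U i)"
      by (simp add: diameter_ge_0 U(2))
    have "diameter (U i) ^ card S \<le> diameter (U i) powr s"
    proof (cases "diameter (U i) = 0")
      case True
      then show ?thesis
        using s by (auto simp: power_0_left)
    next
      case False
      with D s(2) U(3)[of i] show ?thesis
        by (simp add: powr_mono' flip: powr_realpow)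
    qed
    then show "emeasure lborel (B i) \<le> ennreal (2 ^ DIM('a)) * ennreal (diameter (U i) powr s)"
      unfolding B_def content[OF D] using D by (simp add: ennreal_leI flip: ennreal_mult)
  qed auto
  also have "\<dots> = ennreal (2 ^ DIM('a)) * (\<Sum>i. ennreal (diameter (U i) powr s))"
    by simp
  also have "\<dots> < ennreal (2 ^ DIM('a)) * ennreal (r ^ card S)"
    by (intro ennreal_mult_strict_left_mono U(4)) auto
  also have "\<dots> = emeasure lborel (cbox (0 - h r) (0 + h r))"
    using r by (subst content) (simp_all flip: ennreal_mult)
  finally show False
    by simp
qed

theorem hausdorff_dim_eq: "hausdorff_dim K = real (card S)"
proof -
  let ?T = "{s. 0 < s \<and> hausdorff_measure s K = 0}"
  have mem: "s \<in> ?T" if "s > real (card S)" for s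
    using that hausdorff_null_above[OF that] by (auto intro: le_less_trans[OF of_nat_0_le_iff])
  have lower: "real (card S) \<le> s" if "s \<in> ?T" for s
    using that not_hausdorff_null_below[of s] by force
  have "Inf ?T = real (card S)"
  proof (rule antisym)
    show "Inf ?T \<le> real (card S)"
    proof (rule field_le_epsilon)
      fix e :: real assume "e > 0"
      then have "real (card S) + e \<in> ?T"
        by (intro mem) simp
      then show "Inf ?T \<le> real (card S) + e"
        using lower by (intro cInf_lower bdd_belowI)
    qed
    have "?T \<noteq> {}"
      using mem[of "real (card S) + 1"] by (metis empty_iff less_add_one)
    then show "real (card S) \<le> Inf ?T"
      using lower by (rule cInf_greatest)
  qed
  then show ?thesis
    by (simp add: hausdorff_dim_def)
qed

end

section \<open>Rotation invariance of Lebesgue measure\<close>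

lemma ball_linear_isometry_image:
  assumes "linear h" "\<And>x. norm (h x) = norm x" "surj h"
  shows "h ` ball x r = ball (h x) r"
proof -
  have d: "dist (h a) (h b) = dist a b" for a b
    using assms(1,2) by (metis dist_norm linear_diff)
  show ?thesis
  proof (intro equalityI subsetI)
    fix z assume z: "z \<in> ball (h x) r"
    obtain w where "z = h w"
      using assms(3) by blast
    then show "z \<in> h ` ball x r"
      using z d by auto
  qed (use d in auto)
qed

text \<open>By Vitali's covering theorem an open set is a disjoint union of balls up to a null set.  An
  isometry maps balls to balls of the same radius and null sets to null sets.\<close>

lemma emeasure_open_linear_isometry_image:
  fixes h :: "'a::euclidean_space \<Rightarrow> 'a"
  assumes h: "linear h" "\<And>x. norm (h x) = norm x" and U: "open U"
  shows "emeasure lborel (h ` U) = emeasure lborel U"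
proof -
  have inj: "inj h"
    using h by (metis linear_injective_0 norm_eq_zero)
  then have surj: "surj h"
    using h(1) linear_injective_imp_surjective by blast
  have open_image: "open (h ` V)" if "open V" for V
    using open_surjective_linear_image[OF that h(1) surj] .
  let ?I = "{i :: 'a \<times> real. 0 < snd i \<and> ball (fst i) (snd i) \<subseteq> U}"
  have cover: "\<exists>i. i \<in> ?I \<and> x \<in> ball (fst i) (snd i) \<and> snd i < d" if x: "x \<in> U" and d: "0 < d" for x d
  proof -
    obtain r where r: "r > 0" "ball x r \<subseteq> U"
      using U x openE by blast
    then have "ball x (min r (d / 2)) \<subseteq> U"
      by (metis (no_types) min.cobounded1 order_trans subset_ball)
    then show ?thesis
      using r d by (intro exI[of _ "(x, min r (d / 2))"]) auto
  qed
  obtain C where C: "countable C" "C \<subseteq> ?I"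
      "pairwise (\<lambda>i j. disjnt (ball (fst i) (snd i)) (ball (fst j) (snd j))) C"
      "negligible (U - (\<Union>i\<in>C. ball (fst i) (snd i)))"
    by (rule Vitali_covering_theorem_balls[where S = U and K = ?I and a = fst and r = snd, OF cover])
  define B where "B i = ball (fst i) (snd i)" for i :: "'a \<times> real"
  define N where "N = U - (\<Union>i\<in>C. B i)"
  have openB: "open (\<Union>i\<in>C. B i)"
    by (auto simp: B_def)
  have U_eq: "U = (\<Union>i\<in>C. B i) \<union> N"
    using C(2) by (auto simp: N_def B_def)
  have hU_eq: "h ` U = (\<Union>i\<in>C. h ` B i) \<union> h ` N"
    using U_eq by blast
  have null: "A \<in> null_sets lborel" if "negligible A" "A \<in> sets borel" for A :: "'a set"
    using that by (simp add: negligible_iff_null_sets null_sets_completion_iff)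
  have N: "negligible N" "N \<in> sets borel"
    using C(4) U openB by (auto simp: N_def B_def)
  have hN_eq: "h ` N = h ` U - h ` (\<Union>i\<in>C. B i)"
    using inj unfolding N_def by (simp add: image_set_diff)
  have hN: "negligible (h ` N)" "h ` N \<in> sets borel"
  proof -
    show "negligible (h ` N)"
      by (rule negligible_differentiable_image_negligible[OF order_refl N(1)])
        (simp add: linear_imp_differentiable_on h(1))
    show "h ` N \<in> sets borel"
      unfolding hN_eq using open_image[OF U] open_image[OF openB] by auto
  qed
  have "emeasure lborel U = emeasure lborel (\<Union>i\<in>C. B i)"
    unfolding U_eq using openB by (intro emeasure_Un_null_set null N) auto
  also have "\<dots> = (\<integral>\<^sup>+i. emeasure lborel (B i) \<partial>count_space C)"
    using C(1,3) by (intro emeasure_UN_countable)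
      (auto simp: B_def disjoint_family_on_def pairwise_def disjnt_def)
  also have "\<dots> = (\<integral>\<^sup>+i. emeasure lborel (h ` B i) \<partial>count_space C)"
  proof (intro nn_integral_cong)
    fix i assume "i \<in> space (count_space C)"
    then have "0 < snd i"
      using C(2) by auto
    then show "emeasure lborel (B i) = emeasure lborel (h ` B i)"
      unfolding B_def ball_linear_isometry_image[OF h surj] by (simp add: emeasure_ball)
  qed
  also have "\<dots> = emeasure lborel (\<Union>i\<in>C. h ` B i)"
  proof (rule emeasure_UN_countable[symmetric])
    show "disjoint_family_on (\<lambda>i. h ` B i) C"
      using C(3) inj unfolding disjoint_family_on_def pairwise_def disjnt_def B_def
      by (metis image_Int image_empty)
  qed (use C(1) open_image in \<open>auto simp: B_def\<close>)
  also have "\<dots> = emeasure lborel (h ` U)"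
    unfolding hU_eq using open_image[OF openB]
    by (intro emeasure_Un_null_set[symmetric] null hN) (auto simp: image_UN)
  finally show ?thesis ..
qed

lemma distr_lborel_linear_isometry:
  fixes g :: "'a::euclidean_space \<Rightarrow> 'a"
  assumes g: "linear g" "\<And>x. norm (g x) = norm x"
  shows "distr lborel borel g = lborel"
proof -
  have [measurable]: "g \<in> borel \<rightarrow>\<^sub>M borel"
    by (intro borel_measurable_continuous_onI linear_continuous_on linear_conv_bounded_linear[THEN iffD1] g(1))
  have "inj g"
    using g by (metis linear_injective_0 norm_eq_zero)
  then obtain h where h: "linear h" "\<And>x. h (g x) = x" "\<And>x. g (h x) = x"
    using linear_injective_isomorphism[OF g(1)] by blast
  have norm_h: "norm (h x) = norm x" for x
    using g(2)[of "h x"] h(3) by simp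
  have "lborel = distr lborel borel g"
  proof (rule lborel_eqI)
    fix l u :: 'a assume le: "\<And>b. b \<in> Basis \<Longrightarrow> l \<bullet> b \<le> u \<bullet> b"
    have "g -` box l u = h ` box l u"
    proof (intro equalityI subsetI)
      fix x assume "x \<in> g -` box l u"
      then show "x \<in> h ` box l u"
        using h(2)[of x] by (metis image_eqI vimageE)
    qed (use h(3) in auto)
    then have "emeasure (distr lborel borel g) (box l u) = emeasure lborel (h ` box l u)"
      by (simp add: emeasure_distr)
    also have "\<dots> = emeasure lborel (box l u)"
      by (rule emeasure_open_linear_isometry_image[OF h(1) norm_h open_box])
    finally show "emeasure (distr lborel borel g) (box l u) = (\<Prod>b\<in>Basis. (u - l) \<bullet> b)"
      using le by simp
  qed simp
  then show ?thesis ..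
qed

section \<open>Distance and volume near a relatively interior point\<close>

context convex_in_flat
begin

definition tang_sq :: "'a \<Rightarrow> real" where
  "tang_sq x = (\<Sum>b\<in>S. ((x - y) \<bullet> f b)\<^sup>2)"

definition perp_sq :: "'a \<Rightarrow> real" where
  "perp_sq x = (\<Sum>b\<in>Basis - S. ((x - y) \<bullet> f b)\<^sup>2)"

definition codim :: nat where
  "codim = card (Basis - S)"

lemma tang_sq_nonneg: "tang_sq x \<ge> 0" and perp_sq_nonneg: "perp_sq x \<ge> 0"
  by (simp_all add: tang_sq_def perp_sq_def sum_nonneg)

lemma continuous_on_tang_sq [continuous_intros]: "continuous_on A tang_sq"
  and continuous_on_perp_sq [continuous_intros]: "continuous_on A perp_sq"
  unfolding tang_sq_def perp_sq_def by (intro continuous_intros)+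

lemma measurable_tang_sq [measurable]: "tang_sq \<in> borel_measurable borel"
  and measurable_perp_sq [measurable]: "perp_sq \<in> borel_measurable borel"
  by (intro borel_measurable_continuous_onI continuous_intros)+

lemma norm_diff_sq: "(norm (x - y))\<^sup>2 = tang_sq x + perp_sq x"
proof -
  have "(norm (x - y))\<^sup>2 = (\<Sum>b\<in>Basis. ((x - y) \<bullet> f b)\<^sup>2)"
    unfolding power2_norm_eq_inner by (subst frame_inner[OF frame]) (simp add: power2_eq_square)
  also have "\<dots> = tang_sq x + perp_sq x"
    unfolding tang_sq_def perp_sq_def using S_Basis by (simp add: sum.subset_diff)
  finally show ?thesis .
qed

text \<open>The foot \<open>q\<close> of the perpendicular from \<open>x\<close> to the flat belongs to \<open>K\<close>, because its distance from
  \<open>y\<close> is at most \<open>\<rho>\<close>.  All points of \<open>K\<close> have the normal coordinates of \<open>y\<close>, so none is closer.\<close>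

lemma infdist_near_y:
  assumes "tang_sq x \<le> \<rho>\<^sup>2"
  shows "infdist x K = sqrt (perp_sq x)"
proof (rule antisym)
  define q where "q = y + frame_map f (\<Sum>b\<in>S. ((x - y) \<bullet> f b) *\<^sub>R b)"
  have q_inner: "(q - y) \<bullet> f b = (if b \<in> S then (x - y) \<bullet> f b else 0)" if "b \<in> Basis" for b
    using that by (simp add: q_def frame_map_inner[OF frame] inner_sum_Basis_subset[OF S_Basis])
  have "tang_sq q = tang_sq x" "perp_sq q = 0"
    unfolding tang_sq_def perp_sq_def using S_Basis by (auto intro!: sum.cong simp: q_inner)
  then have "(norm (q - y))\<^sup>2 \<le> \<rho>\<^sup>2"
    using assms by (simp add: norm_diff_sq)
  then have "norm (q - y) \<le> \<rho>"
    using \<rho>_pos by (simp add: power2_le_iff_abs_le)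
  then have q: "q \<in> K"
    by (intro flat_ball_K) (auto simp: dist_norm norm_minus_commute q_inner)
  have "(norm (x - q))\<^sup>2 = (\<Sum>b\<in>Basis. ((x - q) \<bullet> f b)\<^sup>2)"
    unfolding power2_norm_eq_inner by (subst frame_inner[OF frame]) (simp add: power2_eq_square)
  also have "\<dots> = (\<Sum>b\<in>Basis. ((x - y) \<bullet> f b - (q - y) \<bullet> f b)\<^sup>2)"
    by (simp add: inner_simps)
  also have "\<dots> = (\<Sum>b\<in>Basis - S. ((x - y) \<bullet> f b)\<^sup>2)"
    by (intro sum.mono_neutral_cong_right) (auto simp: q_inner)
  finally have "(norm (x - q))\<^sup>2 = perp_sq x"
    by (simp add: perp_sq_def)
  then have "norm (x - q) = sqrt (perp_sq x)"
    by (metis norm_ge_zero real_sqrt_unique)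
  then show "infdist x K \<le> sqrt (perp_sq x)"
    using infdist_le[OF q, of x] by (simp add: dist_norm)
  have "sqrt (perp_sq x) \<le> dist x a" if a: "a \<in> K" for a
  proof -
    have "perp_sq x = (\<Sum>b\<in>Basis - S. ((x - a) \<bullet> f b)\<^sup>2)"
      unfolding perp_sq_def using K_flat[OF a] by (intro sum.cong) (auto simp: inner_simps)
    also have "\<dots> \<le> (\<Sum>b\<in>Basis. ((x - a) \<bullet> f b)\<^sup>2)"
      by (intro sum_mono2) auto
    also have "\<dots> = (norm (x - a))\<^sup>2"
      unfolding power2_norm_eq_inner by (subst frame_inner[OF frame, of "x - a"]) (simp add: power2_eq_square)
    finally show ?thesis
      by (simp add: dist_norm real_le_lsqrt)
  qed
  then show "sqrt (perp_sq x) \<le> infdist x K"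
    using y_K by (subst infdist_notempty) (auto intro!: cINF_greatest)
qed

text \<open>A rotation into frame coordinates, preceded by a scaling of the normal directions only; its
  determinant is \<open>s ^ codim\<close> up to sign.\<close>

definition flat_scaling :: "real \<Rightarrow> 'a \<Rightarrow> 'a" where
  "flat_scaling s z = y + frame_map f (\<Sum>b\<in>Basis. ((if b \<in> S then 1 else s) * (z \<bullet> b)) *\<^sub>R b)"

lemma flat_scaling_inner:
  "b \<in> Basis \<Longrightarrow> (flat_scaling s z - y) \<bullet> f b = (if b \<in> S then 1 else s) * (z \<bullet> b)"
  by (simp add: flat_scaling_def frame_map_inner[OF frame])

lemma tang_sq_flat_scaling: "tang_sq (flat_scaling s z) = (\<Sum>b\<in>S. (z \<bullet> b)\<^sup>2)"
  unfolding tang_sq_def using S_Basis by (intro sum.cong) (auto simp: flat_scaling_inner)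

lemma perp_sq_flat_scaling: "perp_sq (flat_scaling s z) = s\<^sup>2 * (\<Sum>b\<in>Basis - S. (z \<bullet> b)\<^sup>2)"
  unfolding perp_sq_def sum_distrib_left
  by (intro sum.cong) (auto simp: flat_scaling_inner power_mult_distrib)

lemma emeasure_flat_scaling:
  assumes A: "A \<in> sets borel" and s: "s > 0"
  shows "emeasure lborel A = ennreal (s ^ codim) * emeasure lborel (flat_scaling s -` A)"
proof -
  define c where "c b = (if b \<in> S then 1 else s)" for b
  define T where "T z = (\<Sum>b\<in>Basis. (c b * (z \<bullet> b)) *\<^sub>R b)" for z :: 'a
  have T [measurable]: "T \<in> borel \<rightarrow>\<^sub>M borel"
    unfolding T_def by measurable
  have g [measurable]: "frame_map f \<in> borel \<rightarrow>\<^sub>M borel"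
    unfolding frame_map_def by measurable
  have "(\<Prod>b\<in>Basis. \<bar>c b\<bar>) = (\<Prod>b\<in>Basis - S. s)"
    using s by (intro prod.mono_neutral_cong_right) (auto simp: c_def)
  then have det: "(\<Prod>b\<in>Basis. \<bar>c b\<bar>) = s ^ codim"
    by (simp add: codim_def)
  have "emeasure lborel A = emeasure lborel ((+) y -` A)"
    using A by (subst lborel_distr_plus[of y, symmetric], subst emeasure_distr) auto
  also have "\<dots> = emeasure lborel (frame_map f -` (+) y -` A)"
    by (subst distr_lborel_linear_isometry[OF linear_frame_map norm_frame_map[OF frame], symmetric])
      (use A in \<open>subst emeasure_distr; auto intro!: measurable_sets_borel[of "(+) y"]\<close>)
  also have "\<dots> = ennreal (s ^ codim) * emeasure lborel (T -` frame_map f -` (+) y -` A)"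
  proof -
    have B: "frame_map f -` (+) y -` A \<in> sets borel" (is "?B \<in> _")
      using A by (intro measurable_sets_borel[OF g] measurable_sets_borel[of "(+) y"]) auto
    have "lborel = density (distr lborel borel T) (\<lambda>_. ennreal (s ^ codim))"
      using lborel_affine_euclidean[of c 0] s unfolding det[symmetric] T_def by (simp add: c_def)
    then have "emeasure lborel ?B = emeasure (density (distr lborel borel T) (\<lambda>_. ennreal (s ^ codim))) ?B"
      by simp
    also have "\<dots> = ennreal (s ^ codim) * emeasure lborel (T -` ?B)"
      using B by (simp add: emeasure_density nn_integral_cmult_indicator emeasure_distr)
    finally show ?thesis .
  qed
  also have "T -` frame_map f -` (+) y -` A = flat_scaling s -` A"
    by (auto simp: flat_scaling_def T_def c_def)
  finally show ?thesis .
qed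

text \<open>The points whose distance from the flat lies in the interval from \<open>exp (- (j + 1))\<close>, excluded, to
  \<open>exp (- j)\<close>, expressed by squares.\<close>

definition shell :: "real \<Rightarrow> nat \<Rightarrow> 'a set" where
  "shell R j = {x. tang_sq x \<le> R \<and> exp (- (2 * (real j + 1))) < perp_sq x \<and> perp_sq x \<le> exp (- (2 * real j))}"

lemma shell_borel [measurable]: "shell R j \<in> sets borel"
  unfolding shell_def by measurable

lemma bounded_shell: "bounded (shell R j)"
proof (rule boundedI)
  fix x assume x: "x \<in> shell R j"
  have "exp (- (2 * real j)) \<le> 1"
    by simp
  then have "perp_sq x \<le> 1"
    using x unfolding shell_def mem_Collect_eq by linarith
  then have "(norm (x - y))\<^sup>2 \<le> R + 1"
    unfolding norm_diff_sq using x by (simp add: shell_def)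
  then have "norm (x - y) \<le> sqrt (R + 1)"
    by (rule real_le_rsqrt)
  then show "norm x \<le> norm y + sqrt (R + 1)"
    using norm_triangle_sub[of x y] by linarith
qed

lemma emeasure_shell_finite: "emeasure lborel (shell R j) < \<infinity>"
  using bounded_shell by (rule emeasure_bounded_finite)

text \<open>Scaling the normal directions by \<open>exp (- j)\<close> carries the shell with index \<open>0\<close> to the one with
  index \<open>j\<close>.\<close>

lemma measure_shell:
  "measure lborel (shell R j) = exp (- real j) ^ codim * measure lborel (shell R 0)"
proof -
  have "flat_scaling (exp (- real j)) -` shell R j = flat_scaling 1 -` shell R 0"
  proof -
    have "exp (- real j) ^ 2 * t \<le> exp (- (2 * real j)) \<longleftrightarrow> t \<le> 1"
         "exp (- (2 * (real j + 1))) < exp (- real j) ^ 2 * t \<longleftrightarrow> exp (- 2) < t" for t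
    proof -
      have "exp (- real j) ^ 2 = exp (- (2 * real j))"
        by (simp flip: exp_of_nat_mult)
      moreover have "exp (- (2 * (real j + 1))) = exp (- (2 * real j)) * exp (- 2)"
        by (simp flip: exp_add)
      ultimately show "exp (- real j) ^ 2 * t \<le> exp (- (2 * real j)) \<longleftrightarrow> t \<le> 1"
         "exp (- (2 * (real j + 1))) < exp (- real j) ^ 2 * t \<longleftrightarrow> exp (- 2) < t"
        using mult_le_cancel_left_pos[of "exp (- (2 * real j))" t 1] by simp_all
    qed
    then show ?thesis
      by (auto simp: shell_def tang_sq_flat_scaling perp_sq_flat_scaling)
  qed
  then have "emeasure lborel (shell R j) = ennreal (exp (- real j) ^ codim) * emeasure lborel (shell R 0)"
    using emeasure_flat_scaling[of "shell R j" "exp (- real j)"] emeasure_flat_scaling[of "shell R 0" 1]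
    by simp
  then show ?thesis
    by (simp add: measure_def enn2real_mult)
qed

lemma measure_shell_pos:
  assumes "R > 0" "codim > 0"
  shows "measure lborel (shell R 0) > 0"
proof -
  obtain b where b: "b \<in> Basis" "b \<notin> S"
    using assms(2) by (auto simp: codim_def card_gt_0_iff)
  define G where "G = {x. tang_sq x < R \<and> exp (- 2) < perp_sq x \<and> perp_sq x < 1}"
  \<comment> \<open>a point in the interior of the shell: \<open>exp (- 2) < (3/4)\<^sup>2 < 1\<close>\<close>
  define x where "x = y + (3/4) *\<^sub>R f b"
  have inner: "(x - y) \<bullet> f i = (if i = b then 3/4 else 0)" if "i \<in> Basis" for i
    using frame b(1) that by (simp add: x_def orthonormal_frame_def)
  have "tang_sq x = 0"
    unfolding tang_sq_def using S_Basis b by (intro sum.neutral) (auto simp: inner)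
  moreover have "perp_sq x = (\<Sum>i\<in>Basis - S. if i = b then 9/16 else 0)"
    unfolding perp_sq_def by (intro sum.cong) (auto simp: inner power2_eq_square)
  then have "perp_sq x = 9/16"
    using b by simp
  moreover have "exp (- 2 :: real) < 9/16"
  proof -
    have "3 \<le> exp (2 :: real)"
      using exp_ge_add_one_self[of 2] by simp
    then show ?thesis
      by (simp add: exp_minus field_simps)
  qed
  ultimately have "x \<in> G"
    using assms(1) by (simp add: G_def)
  moreover have "open G"
    unfolding G_def by (intro open_Collect_conj open_Collect_less continuous_intros)
  ultimately obtain r where r: "r > 0" "ball x r \<subseteq> G"
    using openE by blast
  have "0 < measure lborel (ball x r)"
    using r(1) by (rule content_ball_pos)
  also have "\<dots> \<le> measure lborel (shell R 0)"
    using r(2) emeasure_shell_finite[of R 0]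
    by (intro measure_mono_fmeasurable fmeasurableI) (auto simp: G_def shell_def)
  finally show ?thesis .
qed

end

section \<open>Gradients and partial integration\<close>

definition gradient :: "('a::euclidean_space \<Rightarrow> real) \<Rightarrow> 'a \<Rightarrow> 'a" where
  "gradient \<phi> x = (\<Sum>b\<in>Basis. partial_deriv b \<phi> x *\<^sub>R b)"

lemma grad_norm_eq: "grad_norm \<phi> x = norm (gradient \<phi> x)"
proof -
  have "norm (gradient \<phi> x) = sqrt (\<Sum>b\<in>Basis. (gradient \<phi> x \<bullet> b) * (gradient \<phi> x \<bullet> b))"
    unfolding norm_eq_sqrt_inner by (subst euclidean_inner) simp
  then show ?thesis
    by (simp add: grad_norm_def gradient_def power2_eq_square)
qed

lemma frechet_derivative_gradient:
  assumes "\<phi> differentiable (at x)"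
  shows "frechet_derivative \<phi> (at x) h = gradient \<phi> x \<bullet> h"
proof -
  have lin: "linear (frechet_derivative \<phi> (at x))"
    using assms by (rule linear_frechet_derivative)
  have "frechet_derivative \<phi> (at x) h = frechet_derivative \<phi> (at x) (\<Sum>b\<in>Basis. (h \<bullet> b) *\<^sub>R b)"
    by (simp only: euclidean_representation)
  also have "\<dots> = (\<Sum>b\<in>Basis. (h \<bullet> b) * partial_deriv b \<phi> x)"
    by (simp add: linear_sum[OF lin] linear_scale[OF lin] partial_deriv_def)
  also have "\<dots> = gradient \<phi> x \<bullet> h"
    by (simp add: gradient_def inner_sum_left inner_commute[of h] mult.commute)
  finally show ?thesis .
qed

lemma has_derivative_gradient:
  assumes "\<phi> differentiable (at x)"
  shows "(\<phi> has_derivative (\<lambda>h. gradient \<phi> x \<bullet> h)) (at x)"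
proof -
  have "frechet_derivative \<phi> (at x) = (\<lambda>h. gradient \<phi> x \<bullet> h)"
    by (intro ext frechet_derivative_gradient assms)
  then show ?thesis
    using frechet_derivative_works[THEN iffD1, OF assms] by simp
qed

lemma gradient_unique:
  assumes "(\<phi> has_derivative (\<lambda>h. v \<bullet> h)) (at x)"
  shows "gradient \<phi> x = v"
proof -
  have "frechet_derivative \<phi> (at x) = (\<lambda>h. v \<bullet> h)"
    using frechet_derivative_at[OF assms] by simp
  then show ?thesis
    by (simp add: gradient_def partial_deriv_def euclidean_representation)
qed

lemma C1_compact_supportD:
  assumes "\<phi> \<in> C1_compact_support \<Omega>"
  shows "compact (closure {x. \<phi> x \<noteq> 0})" "closure {x. \<phi> x \<noteq> 0} \<subseteq> \<Omega>"
    "(\<phi> has_derivative (\<lambda>h. gradient \<phi> x \<bullet> h)) (at x)"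
    "continuous_on A \<phi>" "continuous_on A (gradient \<phi>)"
    "x \<notin> closure {x. \<phi> x \<noteq> 0} \<Longrightarrow> \<phi> x = 0" "x \<notin> closure {x. \<phi> x \<noteq> 0} \<Longrightarrow> gradient \<phi> x = 0"
proof -
  let ?C = "closure {x. \<phi> x \<noteq> 0}"
  have diff: "\<phi> differentiable (at x)" for x
    using assms by (simp add: C1_compact_support_def)
  show "compact ?C" "?C \<subseteq> \<Omega>"
    using assms by (simp_all add: C1_compact_support_def)
  show "(\<phi> has_derivative (\<lambda>h. gradient \<phi> x \<bullet> h)) (at x)"
    by (rule has_derivative_gradient[OF diff])
  show "continuous_on A \<phi>"
    by (intro continuous_at_imp_continuous_on ballI differentiable_imp_continuous_within diff)
  have "continuous_on UNIV (gradient \<phi>)"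
    unfolding gradient_def using assms
    by (intro continuous_on_sum continuous_on_scaleR continuous_on_const)
      (auto simp: C1_compact_support_def)
  then show "continuous_on A (gradient \<phi>)"
    by (rule continuous_on_subset) simp
  show zero: "\<phi> x = 0" if "x \<notin> ?C" for x
    using that closure_subset[of "{x. \<phi> x \<noteq> 0}"] by auto
  show "gradient \<phi> x = 0" if "x \<notin> ?C"
  proof (rule gradient_unique)
    have const: "((\<lambda>x. 0) has_derivative (\<lambda>h. 0 \<bullet> h)) (at x)"
      by simp
    show "(\<phi> has_derivative (\<lambda>h. 0 \<bullet> h)) (at x)"
    proof (rule has_derivative_transform_within_open[OF const])
      show "open (- ?C)" "x \<in> - ?C"
        using that by auto
      show "0 = \<phi> z" if "z \<in> - ?C" for z
        using zero[of z] that by (metis ComplD)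
    qed
  qed
qed

lemma C1_compact_supportI:
  assumes deriv: "\<And>x. (\<phi> has_derivative (\<lambda>h. g x \<bullet> h)) (at x)"
    and cont: "continuous_on UNIV g"
    and C: "compact C" "C \<subseteq> \<Omega>" "\<And>x. x \<notin> C \<Longrightarrow> \<phi> x = 0"
  shows "\<phi> \<in> C1_compact_support \<Omega>" "gradient \<phi> x = g x"
proof -
  have "partial_deriv b \<phi> = (\<lambda>x. g x \<bullet> b)" for b
    using frechet_derivative_at[OF deriv] by (simp add: partial_deriv_def fun_eq_iff)
  then have "continuous_on UNIV (partial_deriv b \<phi>)" for b
    using cont by (auto intro: continuous_intros)
  moreover have sub: "closure {x. \<phi> x \<noteq> 0} \<subseteq> C"
    using C by (intro closure_minimal compact_imp_closed) auto
  ultimately show "\<phi> \<in> C1_compact_support \<Omega>"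
    using deriv C compact_closure[of "{x. \<phi> x \<noteq> 0}"] bounded_subset[OF compact_imp_bounded[OF C(1)]]
      closure_subset[of "{x. \<phi> x \<noteq> 0}"]
    by (auto simp: C1_compact_support_def differentiable_def)
  show "gradient \<phi> x = g x"
    by (rule gradient_unique[OF deriv])
qed

lemma integrable_compact_support:
  fixes F :: "'a::euclidean_space \<Rightarrow> real"
  assumes "compact C" "continuous_on C F" "\<And>x. x \<notin> C \<Longrightarrow> F x = 0"
  shows "integrable lborel F"
proof -
  have "integrable lborel (\<lambda>x. indicator C x *\<^sub>R F x)"
    using borel_integrable_compact[OF assms(1,2)] by simp
  also have "(\<lambda>x. indicator C x *\<^sub>R F x) = F"
  proof
    show "indicator C x *\<^sub>R F x = F x" for x
      by (cases "x \<in> C") (simp_all add: assms(3))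
  qed
  finally show ?thesis .
qed

lemma integral_lborel_translate:
  fixes F :: "'a::euclidean_space \<Rightarrow> real"
  assumes "F \<in> borel_measurable borel"
  shows "(\<integral>x. F (x + a) \<partial>lborel) = (\<integral>x. F x \<partial>lborel)"
proof -
  have "(\<integral>x. F x \<partial>lborel) = (\<integral>x. F x \<partial>distr lborel borel ((+) a))"
    by (simp add: lborel_distr_plus)
  also have "\<dots> = (\<integral>x. F (a + x) \<partial>lborel)"
    using assms by (subst integral_distr) auto
  finally show ?thesis
    by (simp add: add.commute)
qed

text \<open>Partial integration at the level of difference quotients: they are moved from \<open>\<psi>\<close> to \<open>w\<close> by
  a translation, and there the lower bound on the increments of \<open>w\<close> applies.  Dominated convergence
  for the quotients of \<open>\<psi>\<close> gives the derivative in the limit.\<close>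

lemma partial_integration_inequality:
  fixes \<psi> w :: "'a::euclidean_space \<Rightarrow> real" and g :: "'a \<Rightarrow> 'a"
  assumes deriv: "\<And>x. (\<psi> has_derivative (\<lambda>h. g x \<bullet> h)) (at x)"
    and C: "compact C" "\<And>x. x \<notin> C \<Longrightarrow> \<psi> x = 0" "\<And>x. x \<notin> C \<Longrightarrow> g x = 0"
    and g: "continuous_on C g" and nonneg: "\<And>x. \<psi> x \<ge> 0"
    and w: "continuous_on UNIV w"
    and incr: "\<And>x h. h > 0 \<Longrightarrow> \<kappa> * h \<le> w x - w (x - h *\<^sub>R e)"
  shows "(\<integral>x. w x * (g x \<bullet> e) \<partial>lborel) \<le> - \<kappa> * (\<integral>x. \<psi> x \<partial>lborel)"
proof -
  define h where "h n = inverse (real (Suc n))" for n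
  have h: "0 < h n" "h n \<le> 1" for n
    by (simp_all add: h_def inverse_le_1_iff)
  have h0: "h \<longlonglongrightarrow> 0"
    unfolding h_def by (rule LIMSEQ_inverse_real_of_nat)
  have cont_\<psi>: "continuous_on A \<psi>" for A
    using deriv by (intro continuous_at_imp_continuous_on ballI has_derivative_continuous)
  have cont_w: "continuous_on A w" for A
    using w by (rule continuous_on_subset) simp
  have [measurable]: "\<psi> \<in> borel_measurable borel" "w \<in> borel_measurable borel"
    using cont_\<psi> cont_w by (auto intro: borel_measurable_continuous_onI)
  define F where "F n x = w x * ((\<psi> (x + h n *\<^sub>R e) - \<psi> x) / h n)" for n x
  have [measurable]: "F n \<in> borel_measurable lborel" for n
    unfolding F_def by measurable
  \<comment> \<open>contains the supports of all difference quotients with step at most \<open>1\<close>\<close>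
  define C' where "C' = {x - z | x z. x \<in> C \<and> z \<in> (\<lambda>t. t *\<^sub>R e) ` {0..1}}"
  have C': "compact C'"
    unfolding C'_def by (intro compact_differences C(1) compact_continuous_image continuous_intros compact_Icc)
  have mem_C': "x \<in> C'" if "x + t *\<^sub>R e \<in> C" "0 \<le> t" "t \<le> 1" for x t
  proof -
    have "x = (x + t *\<^sub>R e) - t *\<^sub>R e"
      by simp
    moreover have "t *\<^sub>R e \<in> (\<lambda>t. t *\<^sub>R e) ` {0..1}"
      using that by auto
    ultimately show ?thesis
      unfolding C'_def using that(1) by blast
  qed
  obtain B where B: "\<And>x. norm (g x) \<le> B" "B \<ge> 0"
  proof -
    obtain B where "\<And>x. x \<in> C \<Longrightarrow> norm (g x) \<le> B"
      using compact_imp_bounded[OF compact_continuous_image[OF g C(1)]] by (auto simp: bounded_iff)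
    then have "norm (g x) \<le> max B 0" for x
      using C(3)[of x] by (cases "x \<in> C") (auto intro: max.coboundedI1)
    then show thesis
      using that[of "max B 0"] by auto
  qed
  obtain M where M: "\<And>x. x \<in> C' \<Longrightarrow> \<bar>w x\<bar> \<le> M"
    using compact_imp_bounded[OF compact_continuous_image[OF cont_w C']] by (auto simp: bounded_iff)
  have lipschitz: "\<bar>\<psi> (x + v) - \<psi> x\<bar> \<le> B * norm v" for x v
  proof -
    have "norm (\<psi> (x + v) - \<psi> x) \<le> B * norm ((x + v) - x)"
    proof (rule differentiable_bound[where S = UNIV and f' = "\<lambda>x h. g x \<bullet> h"])
      show "onorm (\<lambda>h. g x \<bullet> h) \<le> B" for x
      proof (rule onorm_le)
        fix h
        have "norm (g x \<bullet> h) \<le> norm (g x) * norm h"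
          using Cauchy_Schwarz_ineq2 by simp
        also have "\<dots> \<le> B * norm h"
          by (intro mult_right_mono B norm_ge_zero)
        finally show "norm (g x \<bullet> h) \<le> B * norm h" .
      qed
    qed (use deriv in \<open>auto intro: has_derivative_at_withinI\<close>)
    then show ?thesis
      by simp
  qed
  have bound: "\<bar>F n x\<bar> \<le> M * (B * norm e) * indicator C' x" for n x
  proof (cases "x \<in> C'")
    case True
    have "\<bar>(\<psi> (x + h n *\<^sub>R e) - \<psi> x) / h n\<bar> \<le> B * norm e"
      using lipschitz[of x "h n *\<^sub>R e"] h[of n] by (simp add: abs_divide field_simps)
    then have "\<bar>F n x\<bar> \<le> M * (B * norm e)"
      unfolding F_def abs_mult using M[OF True] by (intro mult_mono) auto
    then show ?thesis
      using True by simp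
  next
    case False
    then have "x \<notin> C" "x + h n *\<^sub>R e \<notin> C"
      using mem_C'[of x 0] mem_C'[of x "h n"] h[of n] by auto
    then show ?thesis
      using False by (simp add: F_def C(2))
  qed
  have lim: "(\<lambda>n. F n x) \<longlonglongrightarrow> w x * (g x \<bullet> e)" for x
  proof -
    have "((\<lambda>t. x + t *\<^sub>R e) has_derivative (\<lambda>t. t *\<^sub>R e)) (at 0)"
      by (auto intro!: derivative_eq_intros)
    from has_derivative_compose[OF this, of \<psi> "\<lambda>h. g x \<bullet> h"] deriv[of x]
    have "((\<lambda>t. \<psi> (x + t *\<^sub>R e)) has_derivative (\<lambda>t. t * (g x \<bullet> e))) (at 0)"
      by simp
    then have "((\<lambda>t. \<psi> (x + t *\<^sub>R e)) has_real_derivative (g x \<bullet> e)) (at 0)"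
      unfolding has_field_derivative_def by (simp add: mult_commute_abs)
    then have "((\<lambda>t. (\<psi> (x + t *\<^sub>R e) - \<psi> x) / t) \<longlongrightarrow> g x \<bullet> e) (at 0)"
      unfolding DERIV_def by simp
    moreover have "filterlim h (at 0) sequentially"
      using h0 h(1) by (simp add: filterlim_at less_imp_neq[symmetric])
    ultimately have "(\<lambda>n. (\<psi> (x + h n *\<^sub>R e) - \<psi> x) / h n) \<longlonglongrightarrow> g x \<bullet> e"
      by (rule filterlim_compose)
    then show ?thesis
      unfolding F_def by (intro tendsto_mult tendsto_const)
  qed
  have int_bound: "integrable lborel (\<lambda>x. M * (B * norm e) * indicator C' x)"
    using C' by (intro integrable_compact_support[OF C'] continuous_on_mult continuous_on_const)
      (auto intro: continuous_on_eq[OF continuous_on_const[of C' 1]])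
  have int_conv: "(\<lambda>n. \<integral>x. F n x \<partial>lborel) \<longlonglongrightarrow> (\<integral>x. w x * (g x \<bullet> e) \<partial>lborel)"
  proof (rule integral_dominated_convergence[OF _ _ int_bound])
    show "(\<lambda>x. w x * (g x \<bullet> e)) \<in> borel_measurable lborel"
      by (rule borel_measurable_LIMSEQ_real[OF lim]) measurable
  qed (use lim bound in auto)
  have int_le: "(\<integral>x. F n x \<partial>lborel) \<le> - \<kappa> * (\<integral>x. \<psi> x \<partial>lborel)" for n
  proof -
    let ?v = "h n *\<^sub>R e"
    have int_\<psi>: "integrable lborel \<psi>"
      by (rule integrable_compact_support[OF C(1) cont_\<psi> C(2)])
    have int_w\<psi>: "integrable lborel (\<lambda>x. w x * \<psi> x)"
      by (rule integrable_compact_support[OF C(1)]) (auto intro: continuous_intros cont_\<psi> cont_w C(2))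
    have int_shift: "integrable lborel (\<lambda>x. w (x - ?v) * \<psi> x)"
      by (rule integrable_compact_support[OF C(1)])
        (auto intro!: continuous_intros cont_\<psi> continuous_on_compose2[OF w] C(2))
    have int_shift': "integrable lborel (\<lambda>x. w x * \<psi> (x + ?v))"
    proof (rule integrable_compact_support[OF C'])
      show "continuous_on C' (\<lambda>x. w x * \<psi> (x + ?v))"
        by (intro continuous_intros cont_w continuous_on_compose2[OF cont_\<psi>]) auto
      show "w x * \<psi> (x + ?v) = 0" if "x \<notin> C'" for x
        using that mem_C'[of x "h n"] h[of n] C(2)[of "x + ?v"] by auto
    qed
    have "(\<integral>x. F n x \<partial>lborel) = (\<integral>x. (w x * \<psi> (x + ?v) - w x * \<psi> x) / h n \<partial>lborel)"
      by (intro Bochner_Integration.integral_cong) (auto simp: F_def algebra_simps)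
    also have "\<dots> = ((\<integral>x. w x * \<psi> (x + ?v) \<partial>lborel) - (\<integral>x. w x * \<psi> x \<partial>lborel)) / h n"
      using int_shift' int_w\<psi> by simp
    also have "(\<integral>x. w x * \<psi> (x + ?v) \<partial>lborel) = (\<integral>x. w (x - ?v) * \<psi> x \<partial>lborel)"
      using integral_lborel_translate[of "\<lambda>x. w (x - ?v) * \<psi> x" ?v] by simp
    also have "(\<integral>x. w (x - ?v) * \<psi> x \<partial>lborel) - (\<integral>x. w x * \<psi> x \<partial>lborel)
        = (\<integral>x. w (x - ?v) * \<psi> x - w x * \<psi> x \<partial>lborel)"
      using int_shift int_w\<psi> by simp
    also have "\<dots> \<le> (\<integral>x. - (\<kappa> * h n) * \<psi> x \<partial>lborel)"
    proof (rule integral_mono)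
      fix x
      have "w (x - ?v) - w x \<le> - (\<kappa> * h n)"
        using incr[of "h n" x] h(1)[of n] by simp
      then have "(w (x - ?v) - w x) * \<psi> x \<le> - (\<kappa> * h n) * \<psi> x"
        by (rule mult_right_mono) (rule nonneg)
      then show "w (x - ?v) * \<psi> x - w x * \<psi> x \<le> - (\<kappa> * h n) * \<psi> x"
        by (simp only: left_diff_distrib)
    qed (use int_shift int_w\<psi> int_\<psi> in auto)
    finally show ?thesis
      using h[of n] by (simp add: divide_right_mono field_simps)
  qed
  show ?thesis
    by (rule LIMSEQ_le_const2[OF int_conv]) (use int_le in auto)
qed

section \<open>The weighted Hardy inequality\<close>

lemma Young_powr:
  fixes a b p :: real
  assumes "p \<ge> 1" "a \<ge> 0" "b \<ge> 0"
  shows "p * a powr (p - 1) * b \<le> (p - 1) * a powr p + b powr p"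
proof (cases "p = 1")
  case True
  then show ?thesis
    using assms by (auto simp: powr_def)
next
  case False
  then have p: "p > 1"
    using assms by simp
  have "b * a powr (p - 1) \<le> b powr p / p + (a powr (p - 1)) powr (p / (p - 1)) / (p / (p - 1))"
    using p assms by (intro Youngs_inequality) (auto simp: field_simps)
  also have "(a powr (p - 1)) powr (p / (p - 1)) = a powr p"
    using p by (simp add: powr_powr)
  finally have "p * (b * a powr (p - 1)) \<le> p * (b powr p / p + a powr p / (p / (p - 1)))"
    using p by (intro mult_left_mono) auto
  also have "\<dots> = (p - 1) * a powr p + b powr p"
    using p by (simp add: field_simps)
  finally show ?thesis
    by (simp add: mult_ac)
qed

text \<open>The function \<open>c(t) t powr (- p)\<close> in terms of \<open>s = t\<^sup>2\<close>.  The square of the distance is the better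
  variable, because it is differentiable everywhere with an explicit gradient.\<close>

definition hardy_kernel :: "real \<Rightarrow> real \<Rightarrow> real \<Rightarrow> real \<Rightarrow> real" where
  "hardy_kernel \<delta> \<delta>' p s = s powr ((\<delta> - p) / 2) * (1 + sqrt s) powr (\<delta>' - \<delta>)"

text \<open>The derivative is factored in such a way that the sign of the second summand can be read off
  when \<open>\<delta> \<le> \<delta>'\<close>.\<close>

definition hardy_kernel_deriv :: "real \<Rightarrow> real \<Rightarrow> real \<Rightarrow> real \<Rightarrow> real" where
  "hardy_kernel_deriv \<delta> \<delta>' p s =
     hardy_kernel \<delta> \<delta>' p s / (2 * s) * ((\<delta> - p) + (\<delta>' - \<delta>) * (sqrt s / (1 + sqrt s)))"

lemma hardy_kernel_nonneg: "hardy_kernel \<delta> \<delta>' p s \<ge> 0"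
  by (simp add: hardy_kernel_def)

lemma hardy_kernel_square:
  assumes "t > 0"
  shows "hardy_kernel \<delta> \<delta>' p (t\<^sup>2) = weight \<delta> \<delta>' t * t powr (- p)"
proof -
  have "(t\<^sup>2) powr ((\<delta> - p) / 2) = (t powr 2) powr ((\<delta> - p) / 2)"
    using assms by (simp add: powr_numeral)
  also have "\<dots> = t powr (\<delta> - p)"
    by (simp add: powr_powr diff_divide_distrib)
  also have "\<dots> = t powr \<delta> * t powr (- p)"
    by (simp flip: powr_add)
  finally show ?thesis
    using assms by (simp add: hardy_kernel_def weight_def)
qed

lemma hardy_kernel_has_derivative:
  assumes "s > 0"
  shows "(hardy_kernel \<delta> \<delta>' p has_real_derivative hardy_kernel_deriv \<delta> \<delta>' p s) (at s)"
proof -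
  define a where "a = (\<delta> - p) / 2"
  define c where "c = \<delta>' - \<delta>"
  define r where "r = sqrt s"
  have r: "r > 0" "s = r\<^sup>2"
    using assms by (simp_all add: r_def)
  have "((\<lambda>s. s powr a * (1 + sqrt s) powr c) has_real_derivative
      s powr a * ((1 + r) powr c * c / (1 + r) * (inverse r / 2)) + s powr a * a / s * (1 + r) powr c) (at s)"
    using assms r add_pos_pos[OF zero_less_one r(1)] unfolding r_def
    by (auto intro!: derivative_eq_intros simp: powr_diff field_simps)
  also have "s powr a * ((1 + r) powr c * c / (1 + r) * (inverse r / 2)) + s powr a * a / s * (1 + r) powr c
      = s powr a * (1 + r) powr c / (2 * s) * (2 * a + c * (r / (1 + r)))"
    using r(1) unfolding r(2) by (simp add: divide_simps) (simp add: algebra_simps power2_eq_square)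
  finally show ?thesis
    unfolding hardy_kernel_deriv_def hardy_kernel_def a_def c_def r_def by (simp add: hardy_kernel_def[abs_def] diff_divide_distrib)
qed

lemma continuous_on_hardy_kernel: "continuous_on {0<..} (hardy_kernel \<delta> \<delta>' p)"
  by (rule continuous_at_imp_continuous_on)
    (metis DERIV_isCont hardy_kernel_has_derivative greaterThan_iff)

lemma continuous_on_hardy_kernel_deriv: "continuous_on {0<..} (hardy_kernel_deriv \<delta> \<delta>' p)"
proof -
  have "1 + sqrt s \<noteq> 0" if "s > 0" for s
    using that real_sqrt_gt_zero[OF that] by linarith
  then show ?thesis
    unfolding hardy_kernel_deriv_def
    by (intro continuous_intros continuous_on_hardy_kernel) auto
qed

context convex_in_flat
begin

abbreviation proj :: "'a \<Rightarrow> 'a" where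
  "proj \<equiv> closest_point K"

lemma K_nonempty: "K \<noteq> {}"
  using y_K by blast

lemma proj_in_K: "proj x \<in> K"
  using closed_K K_nonempty by (rule closest_point_in_set)

lemma infdist_proj: "infdist x K = norm (x - proj x)"
  using setdist_closest_point[OF closed_K K_nonempty, of x]
  by (simp add: infdist_eq_setdist dist_norm)

lemma infdist_pos: "x \<notin> K \<Longrightarrow> infdist x K > 0"
  using closed_K K_nonempty by (simp add: infdist_pos_not_in_closed)

lemma proj_nonexpansive: "norm (proj x - proj z) \<le> norm (x - z)"
  using closest_point_lipschitz[OF convex_K closed_K K_nonempty, of x z] by (simp add: dist_norm)

lemma continuous_on_proj: "continuous_on A proj"
  using convex_K closed_K K_nonempty by (rule continuous_on_closest_point)

text \<open>Each of the two squared distances is at most the squared distance to the projection of the other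
  point.  The first comparison gives the upper bound.  The second has its linear term at \<open>x + h\<close>
  instead of \<open>x\<close>, which only improves the lower bound, because the projection is nonexpansive.\<close>

lemma infdist_sq_quadratic_bound:
  "\<bar>(infdist (x + h) K)\<^sup>2 - (infdist x K)\<^sup>2 - (2 *\<^sub>R (x - proj x)) \<bullet> h\<bar> \<le> (norm h)\<^sup>2"
proof -
  let ?D = "\<lambda>x. (infdist x K)\<^sup>2"
  have D: "?D x \<le> (norm (x - q))\<^sup>2" if "q \<in> K" for x q
    using infdist_le[OF that, of x] by (simp add: dist_norm power_mono infdist_nonneg)
  have upper: "?D (x + h) \<le> ?D x + 2 * ((x - proj x) \<bullet> h) + (norm h)\<^sup>2"
    using D[OF proj_in_K, of "x + h" x] unfolding infdist_proj[of x] power2_norm_eq_inner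
    by (simp add: inner_simps inner_commute algebra_simps)
  have "?D x \<le> ?D (x + h) - 2 * ((x + h - proj (x + h)) \<bullet> h) + (norm h)\<^sup>2"
    using D[OF proj_in_K, of x "x + h"] unfolding infdist_proj[of "x + h"] power2_norm_eq_inner
    by (simp add: inner_simps inner_commute algebra_simps)
  moreover have "(proj (x + h) - proj x) \<bullet> h \<le> h \<bullet> h"
  proof -
    have "(proj (x + h) - proj x) \<bullet> h \<le> norm (proj (x + h) - proj x) * norm h"
      by (rule norm_cauchy_schwarz)
    also have "\<dots> \<le> norm h * norm h"
      using proj_nonexpansive[of "x + h" x] by (intro mult_right_mono) auto
    also have "\<dots> = h \<bullet> h"
      by (simp add: power2_norm_eq_inner flip: power2_eq_square)
    finally show ?thesis .
  qed
  ultimately have lower: "?D x + 2 * ((x - proj x) \<bullet> h) - (norm h)\<^sup>2 \<le> ?D (x + h)"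
    by (simp add: inner_simps algebra_simps)
  show ?thesis
    using upper lower by (simp add: abs_le_iff)
qed

lemma infdist_sq_has_derivative:
  "((\<lambda>x. (infdist x K)\<^sup>2) has_derivative (\<lambda>h. (2 *\<^sub>R (x - proj x)) \<bullet> h)) (at x)"
  unfolding has_derivative_at2
proof (intro conjI bounded_linear_inner_right)
  let ?R = "\<lambda>z. (1 / norm (z - x)) *\<^sub>R
      ((infdist z K)\<^sup>2 - ((infdist x K)\<^sup>2 + (2 *\<^sub>R (x - proj x)) \<bullet> (z - x)))"
  have "norm (?R z) \<le> norm (z - x)" for z
  proof (cases "z = x")
    case False
    have "\<bar>(infdist z K)\<^sup>2 - ((infdist x K)\<^sup>2 + (2 *\<^sub>R (x - proj x)) \<bullet> (z - x))\<bar> \<le> (norm (z - x))\<^sup>2"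
      using infdist_sq_quadratic_bound[of x "z - x"] by (simp add: diff_diff_eq)
    with False show ?thesis
      by (simp add: field_simps power2_eq_square)
  qed simp
  moreover have "((\<lambda>z. norm (z - x)) \<longlongrightarrow> 0) (at x)"
    by (auto intro!: tendsto_eq_intros)
  ultimately show "(?R \<longlongrightarrow> 0) (at x)"
    by (intro Lim_null_comparison[of ?R]) auto
qed

text \<open>The divergence of \<open>x - proj x\<close> is at least \<open>codim\<close>.  In a normal direction its component grows at
  rate exactly \<open>1\<close>, because the projections stay in the flat; in a tangential direction it does not
  decrease, because the projection is nonexpansive.\<close>

lemma weak_laplacian_infdist_sq:
  assumes deriv: "\<And>x. (\<psi> has_derivative (\<lambda>h. g x \<bullet> h)) (at x)"
    and C: "compact C" "\<And>x. x \<notin> C \<Longrightarrow> \<psi> x = 0" "\<And>x. x \<notin> C \<Longrightarrow> g x = 0"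
    and g: "continuous_on C g" and nonneg: "\<And>x. \<psi> x \<ge> 0"
  shows "(\<integral>x. (x - proj x) \<bullet> g x \<partial>lborel) \<le> - real codim * (\<integral>x. \<psi> x \<partial>lborel)"
proof -
  define \<kappa> :: "'a \<Rightarrow> real" where "\<kappa> b = (if b \<in> S then 0 else 1)" for b
  have w: "continuous_on A (\<lambda>x. (x - proj x) \<bullet> f b)" for A b
    by (intro continuous_intros continuous_on_proj)
  have "(\<integral>x. (x - proj x) \<bullet> g x \<partial>lborel) = (\<integral>x. (\<Sum>b\<in>Basis. ((x - proj x) \<bullet> f b) * (g x \<bullet> f b)) \<partial>lborel)"
    by (intro Bochner_Integration.integral_cong refl frame_inner[OF frame])
  also have "\<dots> = (\<Sum>b\<in>Basis. \<integral>x. ((x - proj x) \<bullet> f b) * (g x \<bullet> f b) \<partial>lborel)"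
    by (intro Bochner_Integration.integral_sum integrable_compact_support[OF C(1)] continuous_intros
        continuous_on_proj g) (simp add: C(3))
  also have "\<dots> \<le> (\<Sum>b\<in>Basis. - \<kappa> b * (\<integral>x. \<psi> x \<partial>lborel))"
  proof (intro sum_mono partial_integration_inequality[OF deriv C g nonneg w])
    fix b x :: 'a and h :: real
    assume b: "b \<in> Basis" and h: "h > 0"
    have fb: "norm (f b) = 1" "f b \<bullet> f b = 1"
      using frame b by (auto simp: orthonormal_frame_def norm_eq_1)
    define z where "z = x - h *\<^sub>R f b"
    have eq: "(x - proj x) \<bullet> f b - (z - proj z) \<bullet> f b = h - (proj x - proj z) \<bullet> f b"
      by (simp add: z_def inner_simps fb)
    have "\<kappa> b * h \<le> h - (proj x - proj z) \<bullet> f b"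
    proof (cases "b \<in> S")
      case True
      have "(proj x - proj z) \<bullet> f b \<le> norm (proj x - proj z) * norm (f b)"
        by (rule norm_cauchy_schwarz)
      also have "\<dots> \<le> norm (x - z)"
        using proj_nonexpansive fb by simp
      also have "\<dots> = h"
        using h fb by (simp add: z_def)
      finally show ?thesis
        using True by (simp add: \<kappa>_def)
    next
      case False
      then have "(proj x - y) \<bullet> f b = 0" "(proj z - y) \<bullet> f b = 0"
        using b K_flat[OF proj_in_K] by auto
      then have "(proj x - proj z) \<bullet> f b = 0"
        by (simp add: inner_simps)
      then show ?thesis
        using False by (simp add: \<kappa>_def)
    qed
    then show "\<kappa> b * h \<le> (x - proj x) \<bullet> f b - (x - h *\<^sub>R f b - proj (x - h *\<^sub>R f b)) \<bullet> f b"
      using eq unfolding z_def by simp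
  qed auto
  also have "\<dots> = - (\<Sum>b\<in>Basis. \<kappa> b) * (\<integral>x. \<psi> x \<partial>lborel)"
    by (simp add: sum_distrib_right sum_negf)
  also have "(\<Sum>b\<in>Basis. \<kappa> b) = (\<Sum>b\<in>Basis - S. 1)"
    by (intro sum.mono_neutral_cong_right) (auto simp: \<kappa>_def)
  also have "\<dots> = real codim"
    by (simp add: codim_def)
  finally show ?thesis .
qed

lemma kernel_infdist_continuous_on:
  assumes "C \<inter> K = {}"
  shows "continuous_on C (\<lambda>x. hardy_kernel \<delta> \<delta>' p ((infdist x K)\<^sup>2))"
    "continuous_on C (\<lambda>x. hardy_kernel_deriv \<delta> \<delta>' p ((infdist x K)\<^sup>2))"
proof -
  have "(\<lambda>x. (infdist x K)\<^sup>2) ` C \<subseteq> {0<..}"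
    using infdist_pos assms by fastforce
  moreover have "continuous_on C (\<lambda>x. (infdist x K)\<^sup>2)"
    by (intro continuous_intros)
  ultimately show "continuous_on C (\<lambda>x. hardy_kernel \<delta> \<delta>' p ((infdist x K)\<^sup>2))"
    "continuous_on C (\<lambda>x. hardy_kernel_deriv \<delta> \<delta>' p ((infdist x K)\<^sup>2))"
    by (auto intro: continuous_on_compose2[OF continuous_on_hardy_kernel]
        continuous_on_compose2[OF continuous_on_hardy_kernel_deriv])
qed

text \<open>The weak inequality for the Laplacian is tested with the kernel times \<open>G (\<phi> x)\<close>.  Differentiating
  the kernel produces \<open>\<delta> - p\<close> times the test function and a nonnegative remainder, and the term with
  the gradient of \<open>\<phi>\<close> is estimated by the Cauchy-Schwarz inequality.  The function \<open>G\<close> stays general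
  because \<open>\<bar>t\<bar> powr p\<close> itself is not of class \<open>C\<^sup>1\<close> for \<open>p = 1\<close>.\<close>

lemma first_order_hardy:
  fixes G G' :: "real \<Rightarrow> real"
  assumes \<phi>: "\<phi> \<in> C1_compact_support (- K)" and \<delta>: "\<delta> \<le> \<delta>'"
    and G: "\<And>t. (G has_real_derivative G' t) (at t)" "continuous_on UNIV G'" "G 0 = 0" "\<And>t. G t \<ge> 0"
  shows "(real codim + \<delta> - p) * (\<integral>x. hardy_kernel \<delta> \<delta>' p ((infdist x K)\<^sup>2) * G (\<phi> x) \<partial>lborel)
    \<le> (\<integral>x. hardy_kernel \<delta> \<delta>' p ((infdist x K)\<^sup>2) * \<bar>G' (\<phi> x)\<bar> * (infdist x K * norm (gradient \<phi> x)) \<partial>lborel)"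
proof -
  define C where "C = closure {x. \<phi> x \<noteq> 0}"
  note \<phi>D = C1_compact_supportD[OF \<phi>, folded C_def]
  have CK: "C \<inter> K = {}"
    using \<phi>D(2) by blast
  define D where "D x = (infdist x K)\<^sup>2" for x
  define k where "k x = hardy_kernel \<delta> \<delta>' p (D x)" for x
  define k' where "k' x = hardy_kernel_deriv \<delta> \<delta>' p (D x)" for x
  define \<psi> where "\<psi> x = k x * G (\<phi> x)" for x
  define g where "g x = (k' x * G (\<phi> x)) *\<^sub>R (2 *\<^sub>R (x - proj x)) + (k x * G' (\<phi> x)) *\<^sub>R gradient \<phi> x" for x
  define R where "R x = k x * \<bar>G' (\<phi> x)\<bar> * (infdist x K * norm (gradient \<phi> x))" for x
  have cont_k: "continuous_on C k" "continuous_on C k'"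
    using kernel_infdist_continuous_on[OF CK] by (simp_all add: k_def k'_def D_def)
  have cont_G: "continuous_on UNIV G"
    by (rule continuous_at_imp_continuous_on) (metis DERIV_isCont G(1))
  have cont_G\<phi>: "continuous_on C (\<lambda>x. G (\<phi> x))" "continuous_on C (\<lambda>x. G' (\<phi> x))"
    by (rule continuous_on_compose2[OF cont_G \<phi>D(4)] continuous_on_compose2[OF G(2) \<phi>D(4)], simp)+
  have cont_g: "continuous_on C g"
    unfolding g_def by (intro continuous_intros cont_k cont_G\<phi> continuous_on_proj \<phi>D(5))
  have zero: "\<psi> x = 0" "g x = 0" "R x = 0" if "x \<notin> C" for x
    using \<phi>D(6,7)[OF that] G(3) by (simp_all add: \<psi>_def g_def R_def)
  have k_nonneg: "k x \<ge> 0" for x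
    by (simp add: k_def hardy_kernel_nonneg)
  have deriv: "(\<psi> has_derivative (\<lambda>h. g x \<bullet> h)) (at x)" for x
  proof (cases "x \<in> C")
    case True
    then have "x \<notin> K"
      using CK by blast
    then have "D x > 0"
      using infdist_pos[of x] by (simp add: D_def)
    then have "(k has_derivative (\<lambda>h. k' x * ((2 *\<^sub>R (x - proj x)) \<bullet> h))) (at x)"
      using has_derivative_compose[OF infdist_sq_has_derivative,
          OF hardy_kernel_has_derivative[unfolded has_field_derivative_def], of x \<delta> \<delta>' p]
      by (simp add: k_def[abs_def] k'_def D_def)
    moreover have "((\<lambda>x. G (\<phi> x)) has_derivative (\<lambda>h. G' (\<phi> x) * (gradient \<phi> x \<bullet> h))) (at x)"
      using has_derivative_compose[OF \<phi>D(3) G(1)[unfolded has_field_derivative_def]] by simp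
    ultimately have "(\<psi> has_derivative (\<lambda>h. k x * (G' (\<phi> x) * (gradient \<phi> x \<bullet> h))
        + (k' x * ((2 *\<^sub>R (x - proj x)) \<bullet> h)) * G (\<phi> x))) (at x)"
      unfolding \<psi>_def[abs_def] by (rule has_derivative_mult)
    then show ?thesis
      by (rule has_derivative_eq_rhs) (simp add: g_def fun_eq_iff inner_simps algebra_simps)
  next
    case False
    have const: "((\<lambda>x. 0) has_derivative (\<lambda>h. 0 \<bullet> h)) (at x)"
      by simp
    have "(\<psi> has_derivative (\<lambda>h. 0 \<bullet> h)) (at x)"
    proof (rule has_derivative_transform_within_open[OF const])
      show "open (- C)" "x \<in> - C"
        using False \<phi>D(1) by (auto simp: compact_imp_closed open_Compl)
      show "0 = \<psi> z" if "z \<in> - C" for z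
        using zero(1)[of z] that by simp
    qed
    then show ?thesis
      using zero(2)[OF False] by simp
  qed
  have \<psi>_nonneg: "\<psi> x \<ge> 0" for x
    by (simp add: \<psi>_def k_nonneg G(4))
  have pointwise: "(\<delta> - p) * \<psi> x - R x \<le> (x - proj x) \<bullet> g x" for x
  proof (cases "x \<in> C")
    case True
    then have "x \<notin> K"
      using CK by blast
    then have D: "D x > 0"
      using infdist_pos[of x] by (simp add: D_def)
    define r where "r = sqrt (D x) / (1 + sqrt (D x))"
    have "r \<ge> 0"
      using D by (simp add: r_def)
    have sq: "(x - proj x) \<bullet> (x - proj x) = D x"
      by (simp add: D_def infdist_proj power2_norm_eq_inner)
    have "(x - proj x) \<bullet> g x = (2 * D x * k' x) * G (\<phi> x) + k x * G' (\<phi> x) * ((x - proj x) \<bullet> gradient \<phi> x)"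
      unfolding g_def inner_add_right inner_scaleR_right sq by (simp add: mult_ac)
    also have "2 * D x * k' x = k x * ((\<delta> - p) + (\<delta>' - \<delta>) * r)"
      using D by (simp add: k'_def k_def hardy_kernel_deriv_def r_def)
    finally have eq: "(x - proj x) \<bullet> g x = (\<delta> - p) * \<psi> x + (\<delta>' - \<delta>) * r * \<psi> x
        + k x * G' (\<phi> x) * ((x - proj x) \<bullet> gradient \<phi> x)"
      by (simp add: \<psi>_def algebra_simps)
    have "\<bar>k x * G' (\<phi> x) * ((x - proj x) \<bullet> gradient \<phi> x)\<bar>
        = k x * \<bar>G' (\<phi> x)\<bar> * \<bar>(x - proj x) \<bullet> gradient \<phi> x\<bar>"
      using k_nonneg by (simp add: abs_mult)
    also have "\<dots> \<le> R x"
      unfolding R_def infdist_proj using k_nonneg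
      by (intro mult_left_mono Cauchy_Schwarz_ineq2) auto
    finally have "- R x \<le> k x * G' (\<phi> x) * ((x - proj x) \<bullet> gradient \<phi> x)"
      by linarith
    moreover have "0 \<le> (\<delta>' - \<delta>) * r * \<psi> x"
      using \<delta> \<open>r \<ge> 0\<close> \<psi>_nonneg by simp
    ultimately show ?thesis
      unfolding eq by linarith
  next
    case False
    then show ?thesis
      by (simp add: zero)
  qed
  have int_\<psi>: "integrable lborel \<psi>"
    by (rule integrable_compact_support[OF \<phi>D(1) _ zero(1)])
      (unfold \<psi>_def, intro continuous_intros cont_k cont_G\<phi>)
  have int_R: "integrable lborel R"
    by (rule integrable_compact_support[OF \<phi>D(1) _ zero(3)])
      (unfold R_def, intro continuous_intros cont_k cont_G\<phi> \<phi>D(5))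
  have int_g: "integrable lborel (\<lambda>x. (x - proj x) \<bullet> g x)"
    by (rule integrable_compact_support[OF \<phi>D(1)])
      (intro continuous_intros continuous_on_proj cont_g, simp add: zero)
  have "(\<delta> - p) * (\<integral>x. \<psi> x \<partial>lborel) - (\<integral>x. R x \<partial>lborel) = (\<integral>x. (\<delta> - p) * \<psi> x - R x \<partial>lborel)"
    using int_\<psi> int_R by simp
  also have "\<dots> \<le> (\<integral>x. (x - proj x) \<bullet> g x \<partial>lborel)"
    using int_\<psi> int_R int_g pointwise by (intro integral_mono) auto
  also have "\<dots> \<le> - real codim * (\<integral>x. \<psi> x \<partial>lborel)"
    by (rule weak_laplacian_infdist_sq[OF deriv \<phi>D(1) zero(1,2) cont_g \<psi>_nonneg])
  finally have "(real codim + \<delta> - p) * (\<integral>x. \<psi> x \<partial>lborel) \<le> (\<integral>x. R x \<partial>lborel)"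
    by (simp add: algebra_simps)
  then show ?thesis
    by (simp add: \<psi>_def R_def k_def D_def)
qed

lemma integrable_kernel_powr:
  assumes \<phi>: "\<phi> \<in> C1_compact_support (- K)" and p: "p \<ge> 1"
  shows "integrable lborel (\<lambda>x. hardy_kernel \<delta> \<delta>' p ((infdist x K)\<^sup>2) * \<bar>\<phi> x\<bar> powr p)"
proof -
  define C where "C = closure {x. \<phi> x \<noteq> 0}"
  note \<phi>D = C1_compact_supportD[OF \<phi>, folded C_def]
  have "C \<inter> K = {}"
    using \<phi>D(2) by blast
  note cont_k = kernel_infdist_continuous_on(1)[OF this]
  have "continuous_on C (\<lambda>x. \<bar>\<phi> x\<bar> powr p)"
    using p \<phi>D(4) by (intro continuous_on_powr' continuous_intros) auto
  then show ?thesis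
    using \<phi>D(6) by (intro integrable_compact_support[OF \<phi>D(1)] continuous_on_mult cont_k) auto
qed

text \<open>The first order inequality is applied to the smooth function
  \<open>(t\<^sup>2 + \<epsilon>\<^sup>2) powr (p / 2) - \<epsilon> powr p\<close>.  Writing \<open>a\<close> for the square root of \<open>t\<^sup>2 + \<epsilon>\<^sup>2\<close>, Young's
  inequality for \<open>\<alpha> a\<close> and \<open>d\<close> times the gradient leaves \<open>p - 1\<close> of the \<open>p\<close> copies of
  \<open>\<alpha> powr p * a powr p\<close> on the right, so that one copy survives on the left.  Since \<open>a\<close> exceeds
  \<open>\<bar>t\<bar>\<close>, letting \<open>\<epsilon>\<close> tend to \<open>0\<close> only has to remove the term with \<open>\<epsilon> powr p\<close>.\<close>

theorem hardy_inequality: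
  assumes \<phi>: "\<phi> \<in> C1_compact_support (- K)" and \<delta>: "\<delta> \<le> \<delta>'" and p: "p \<ge> 1"
    and pos: "real codim + \<delta> - p > 0"
  shows "((real codim + \<delta> - p) / p) powr p *
      (\<integral>x. hardy_kernel \<delta> \<delta>' p ((infdist x K)\<^sup>2) * \<bar>\<phi> x\<bar> powr p \<partial>lborel)
    \<le> (\<integral>x. hardy_kernel \<delta> \<delta>' p ((infdist x K)\<^sup>2) * (infdist x K * norm (gradient \<phi> x)) powr p \<partial>lborel)"
    (is "_ * ?Den \<le> ?Num")
proof -
  define \<alpha> where "\<alpha> = (real codim + \<delta> - p) / p"
  have \<alpha>: "\<alpha> > 0" "real codim + \<delta> - p = p * \<alpha>"
    using pos p by (simp_all add: \<alpha>_def)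
  define C where "C = closure {x. \<phi> x \<noteq> 0}"
  note \<phi>D = C1_compact_supportD[OF \<phi>, folded C_def]
  have CK: "C \<inter> K = {}"
    using \<phi>D(2) by blast
  define k where "k x = hardy_kernel \<delta> \<delta>' p ((infdist x K)\<^sup>2)" for x
  have cont_k: "continuous_on C k"
    using kernel_infdist_continuous_on(1)[OF CK] by (simp add: k_def)
  have k_nonneg: "k x \<ge> 0" for x
    by (simp add: k_def hardy_kernel_nonneg)
  define N where "N x = k x * (infdist x K * norm (gradient \<phi> x)) powr p" for x
  define Z where "Z = (\<integral>x. indicator C x * k x \<partial>lborel)"
  have N_zero: "N x = 0" if "x \<notin> C" for x
    using \<phi>D(7)[OF that] by (simp add: N_def)
  have int_N: "integrable lborel N"
    using p by (intro integrable_compact_support[OF \<phi>D(1) _ N_zero], unfold N_def)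
      (auto intro!: continuous_intros continuous_on_powr' cont_k \<phi>D(5) mult_nonneg_nonneg infdist_nonneg)
  have int_Z: "integrable lborel (\<lambda>x. indicator C x * k x)"
    by (rule integrable_compact_support[OF \<phi>D(1)])
      (auto intro: continuous_on_eq[OF cont_k])
  have int_Den: "integrable lborel (\<lambda>x. k x * \<bar>\<phi> x\<bar> powr p)"
    unfolding k_def by (rule integrable_kernel_powr[OF \<phi> p])
  have approx: "\<alpha> powr p * ?Den \<le> ?Num + p * \<alpha> powr p * Z * \<epsilon> powr p" if \<epsilon>: "\<epsilon> > 0" for \<epsilon>
  proof -
    define G where "G t = (t\<^sup>2 + \<epsilon>\<^sup>2) powr (p / 2) - \<epsilon> powr p" for t
    define G' where "G' t = p * t * (t\<^sup>2 + \<epsilon>\<^sup>2) powr (p / 2 - 1)" for t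
    define a where "a t = sqrt (t\<^sup>2 + \<epsilon>\<^sup>2)" for t
    have sq_pos: "t\<^sup>2 + \<epsilon>\<^sup>2 > 0" for t
      using \<epsilon> by (simp add: add_nonneg_pos)
    have a_pos: "a t > 0" for t
      using sq_pos by (simp add: a_def)
    have a_powr: "(t\<^sup>2 + \<epsilon>\<^sup>2) powr q = a t powr (2 * q)" for t q
    proof -
      have "t\<^sup>2 + \<epsilon>\<^sup>2 = a t powr 2"
        using sq_pos[of t] a_pos[of t] by (simp add: powr_numeral a_def)
      then show ?thesis
        by (simp add: powr_powr)
    qed
    have a_ge: "\<bar>t\<bar> \<le> a t" "\<epsilon> \<le> a t" for t
      unfolding a_def using \<epsilon> by (auto intro!: real_le_rsqrt)
    have G_eq: "G t = a t powr p - \<epsilon> powr p" for t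
      by (simp add: G_def a_powr)
    have G_deriv: "(G has_real_derivative G' t) (at t)" for t
      unfolding G_def[abs_def] G'_def using sq_pos[of t]
      by (auto intro!: derivative_eq_intros simp: powr_diff field_simps)
    have G'_cont: "continuous_on UNIV G'"
      unfolding G'_def using sq_pos by (intro continuous_intros) (auto simp: less_imp_neq[symmetric])
    have G0: "G 0 = 0"
      using \<epsilon> by (simp add: G_eq a_def)
    have G_nonneg: "G t \<ge> 0" for t
      unfolding G_eq using a_ge(2)[of t] \<epsilon> p by (simp add: powr_mono2)
    have G'_le: "\<bar>G' t\<bar> \<le> p * a t powr (p - 1)" for t
    proof -
      have "\<bar>G' t\<bar> = p * (\<bar>t\<bar> * a t powr (p - 2))"
        unfolding G'_def a_powr using p by (simp add: abs_mult right_diff_distrib)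
      also have "\<dots> \<le> p * (a t * a t powr (p - 2))"
        using p a_ge(1) by (intro mult_left_mono mult_right_mono) auto
      also have "a t * a t powr (p - 2) = a t powr (p - 1)"
        using a_pos[of t] by (simp add: powr_mult_base)
      finally show ?thesis .
    qed
    define A where "A = (\<integral>x. indicator C x * (k x * a (\<phi> x) powr p) \<partial>lborel)"
    have cont_a: "continuous_on C (\<lambda>x. a (\<phi> x))"
      unfolding a_def by (intro continuous_intros \<phi>D(4))
    have int_A: "integrable lborel (\<lambda>x. indicator C x * (k x * a (\<phi> x) powr p))"
    proof (rule integrable_compact_support[OF \<phi>D(1)])
      have "continuous_on C (\<lambda>x. k x * a (\<phi> x) powr p)"
        using a_pos by (intro continuous_intros cont_k cont_a) (auto simp: less_imp_neq[symmetric])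
      then show "continuous_on C (\<lambda>x. indicator C x * (k x * a (\<phi> x) powr p))"
        by (rule continuous_on_eq) simp
    qed simp
    have kG_eq: "k x * G (\<phi> x) = indicator C x * (k x * a (\<phi> x) powr p) - \<epsilon> powr p * (indicator C x * k x)" for x
      using \<phi>D(6)[of x] G0 by (cases "x \<in> C") (simp_all add: G_eq algebra_simps)
    have int_kG: "(\<integral>x. k x * G (\<phi> x) \<partial>lborel) = A - \<epsilon> powr p * Z"
      unfolding kG_eq A_def Z_def using int_A int_Z by simp
    have Den_le: "?Den \<le> A"
      unfolding A_def k_def[symmetric]
    proof (rule integral_mono[OF int_Den int_A])
      show "k x * \<bar>\<phi> x\<bar> powr p \<le> indicator C x * (k x * a (\<phi> x) powr p)" for x
        using \<phi>D(6)[of x] k_nonneg[of x] p a_ge(1)[of "\<phi> x"]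
        by (cases "x \<in> C") (auto intro!: mult_left_mono powr_mono2)
    qed
    define R where "R x = k x * \<bar>G' (\<phi> x)\<bar> * (infdist x K * norm (gradient \<phi> x))" for x
    have int_R: "integrable lborel R"
    proof (rule integrable_compact_support[OF \<phi>D(1)])
      show "continuous_on C R"
        unfolding R_def
        by (intro continuous_intros cont_k \<phi>D(5) continuous_on_compose2[OF G'_cont \<phi>D(4)]) auto
      show "R x = 0" if "x \<notin> C" for x
        using \<phi>D(7)[OF that] by (simp add: R_def)
    qed
    have R_le: "\<alpha> powr (p - 1) * R x
        \<le> (p - 1) * \<alpha> powr p * (indicator C x * (k x * a (\<phi> x) powr p)) + N x" for x
    proof (cases "x \<in> C")
      case True
      define b where "b = infdist x K * norm (gradient \<phi> x)"
      have b: "b \<ge> 0"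
        by (simp add: b_def infdist_nonneg)
      have "\<alpha> powr (p - 1) * (\<bar>G' (\<phi> x)\<bar> * b) \<le> \<alpha> powr (p - 1) * ((p * a (\<phi> x) powr (p - 1)) * b)"
        using b by (intro mult_left_mono mult_right_mono G'_le) auto
      also have "\<dots> = p * (\<alpha> * a (\<phi> x)) powr (p - 1) * b"
        using \<alpha>(1) a_pos[of "\<phi> x"] by (simp add: powr_mult)
      also have "\<dots> \<le> (p - 1) * (\<alpha> * a (\<phi> x)) powr p + b powr p"
        using p \<alpha>(1) a_pos[of "\<phi> x"] b by (intro Young_powr) auto
      also have "(\<alpha> * a (\<phi> x)) powr p = \<alpha> powr p * a (\<phi> x) powr p"
        using \<alpha>(1) a_pos[of "\<phi> x"] by (simp add: powr_mult)
      finally have "k x * (\<alpha> powr (p - 1) * (\<bar>G' (\<phi> x)\<bar> * b))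
          \<le> k x * ((p - 1) * (\<alpha> powr p * a (\<phi> x) powr p) + b powr p)"
        by (rule mult_left_mono) (rule k_nonneg)
      then show ?thesis
        using True by (simp add: R_def N_def b_def algebra_simps)
    next
      case False
      then show ?thesis
        using \<phi>D(7)[OF False] N_zero[OF False] by (simp add: R_def)
    qed
    have "p * \<alpha> * (A - \<epsilon> powr p * Z) \<le> (\<integral>x. R x \<partial>lborel)"
      using first_order_hardy[OF \<phi> \<delta> G_deriv G'_cont G0 G_nonneg, of p] int_kG
      unfolding R_def k_def[symmetric] \<alpha>(2) by simp
    then have "\<alpha> powr (p - 1) * (p * \<alpha> * (A - \<epsilon> powr p * Z)) \<le> \<alpha> powr (p - 1) * (\<integral>x. R x \<partial>lborel)"
      by (intro mult_left_mono) auto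
    also have "\<alpha> powr (p - 1) * (p * \<alpha> * (A - \<epsilon> powr p * Z)) = p * \<alpha> powr p * (A - \<epsilon> powr p * Z)"
      using \<alpha>(1) by (simp add: powr_diff)
    also have "\<alpha> powr (p - 1) * (\<integral>x. R x \<partial>lborel) = (\<integral>x. \<alpha> powr (p - 1) * R x \<partial>lborel)"
      by simp
    also have "\<dots> \<le> (\<integral>x. (p - 1) * \<alpha> powr p * (indicator C x * (k x * a (\<phi> x) powr p)) + N x \<partial>lborel)"
      by (intro integral_mono Bochner_Integration.integrable_add integrable_mult_right int_R int_A int_N R_le)
    also have "\<dots> = (p - 1) * \<alpha> powr p * A + (\<integral>x. N x \<partial>lborel)"
      unfolding A_def using int_A int_N by simp
    finally have "\<alpha> powr p * A \<le> (\<integral>x. N x \<partial>lborel) + p * \<alpha> powr p * Z * \<epsilon> powr p"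
      by (simp add: algebra_simps)
    moreover have "\<alpha> powr p * ?Den \<le> \<alpha> powr p * A"
      using Den_le by (intro mult_left_mono) auto
    ultimately show ?thesis
      by (simp add: N_def k_def)
  qed
  have "((\<lambda>\<epsilon>. ?Num + p * \<alpha> powr p * Z * \<epsilon> powr p) \<longlongrightarrow> ?Num + p * \<alpha> powr p * Z * 0) (at_right 0)"
  proof (intro tendsto_intros)
    have "\<forall>\<^sub>F \<epsilon>::real in at_right 0. 0 \<le> \<epsilon>"
      using eventually_at_right_less[of "0::real"] by eventually_elim simp
    then have "((\<lambda>\<epsilon>. \<epsilon> powr p) \<longlongrightarrow> 0 powr p) (at_right 0)"
      using p by (intro tendsto_powr') (auto intro: tendsto_eq_intros)
    then show "((\<lambda>\<epsilon>. \<epsilon> powr p) \<longlongrightarrow> 0) (at_right 0)"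
      by simp
  qed
  then have "\<alpha> powr p * ?Den \<le> ?Num + p * \<alpha> powr p * Z * 0"
    by (rule tendsto_lowerbound)
      (auto simp: eventually_at_filter intro!: approx always_eventually)
  then show ?thesis
    by (simp add: \<alpha>_def)
qed

text \<open>A vanishing denominator would give the value \<open>0\<close> to the quotient, because \<open>x / 0 = 0\<close>.\<close>

lemma hardy_denominator_pos:
  assumes \<phi>: "\<phi> \<in> C1_compact_support (- K)" and nz: "\<phi> \<noteq> (\<lambda>x. 0)" and p: "p \<ge> 1"
  shows "(\<integral>x. hardy_kernel \<delta> \<delta>' p ((infdist x K)\<^sup>2) * \<bar>\<phi> x\<bar> powr p \<partial>lborel) > 0"
proof -
  let ?F = "\<lambda>x. hardy_kernel \<delta> \<delta>' p ((infdist x K)\<^sup>2) * \<bar>\<phi> x\<bar> powr p"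
  note \<phi>D = C1_compact_supportD[OF \<phi>]
  define U where "U = {x. \<phi> x \<noteq> 0}"
  have U: "open U"
    unfolding U_def by (rule open_Collect_neq[OF \<phi>D(4) continuous_on_const])
  have "U \<noteq> {}"
    using nz by (auto simp: U_def fun_eq_iff)
  have nonneg: "?F x \<ge> 0" for x
    by (simp add: hardy_kernel_nonneg)
  have pos: "?F x \<noteq> 0" if "x \<in> U" for x
  proof -
    have "x \<notin> K"
      using subsetD[OF \<phi>D(2) subsetD[OF closure_subset that[unfolded U_def]]] by simp
    then have "infdist x K > 0"
      by (rule infdist_pos)
    then have "hardy_kernel \<delta> \<delta>' p ((infdist x K)\<^sup>2) > 0"
      by (simp add: hardy_kernel_def infdist_nonneg add_pos_nonneg)
    then show ?thesis
      using that by (simp add: U_def)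
  qed
  have "(\<integral>x. ?F x \<partial>lborel) \<noteq> 0"
  proof
    assume "(\<integral>x. ?F x \<partial>lborel) = 0"
    then have "AE x in lborel. ?F x = 0"
      using integral_nonneg_eq_0_iff_AE[OF integrable_kernel_powr[OF \<phi> p]] nonneg by simp
    then have "AE x in lborel. x \<notin> U"
      by eventually_elim (use pos in blast)
    then have "U \<in> null_sets lborel"
      using U by (subst AE_iff_null_sets) auto
    then have "negligible U"
      by (simp add: negligible_iff_null_sets null_sets_completionI)
    with U \<open>U \<noteq> {}\<close> show False
      using open_not_negligible by blast
  qed
  moreover have "(\<integral>x. ?F x \<partial>lborel) \<ge> 0"
    by (intro integral_nonneg_AE AE_I2 nonneg)
  ultimately show ?thesis
    by simp
qed

end

section \<open>Trial functions\<close>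

text \<open>Whichever of \<open>b\<close> and \<open>\<eta> a\<close> is larger absorbs the other.\<close>

lemma powr_add_le:
  fixes a b \<eta> p :: real
  assumes "a \<ge> 0" "b \<ge> 0" "\<eta> > 0" "p \<ge> 0"
  shows "(a + b) powr p \<le> (1 + \<eta>) powr p * a powr p + (1 + 1 / \<eta>) powr p * b powr p"
proof (cases "b \<le> \<eta> * a")
  case True
  have "(a + b) powr p \<le> ((1 + \<eta>) * a) powr p"
    using True assms by (intro powr_mono2) (auto simp: algebra_simps)
  also have "\<dots> = (1 + \<eta>) powr p * a powr p"
    using assms by (simp add: powr_mult)
  finally show ?thesis
    by (simp add: add_increasing2)
next
  case False
  have "(a + b) powr p \<le> ((1 + 1 / \<eta>) * b) powr p"
    using False assms by (intro powr_mono2) (auto simp: field_simps)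
  also have "\<dots> = (1 + 1 / \<eta>) powr p * b powr p"
    using assms by (simp add: powr_mult)
  finally show ?thesis
    by (simp add: add_increasing)
qed

text \<open>A cutoff of class \<open>C\<^sup>1\<close> that is applied to squares only, so its growth at negative arguments does
  no harm.\<close>

definition bump :: "real \<Rightarrow> real" where
  "bump s = (max 0 (1 - s))\<^sup>2"

definition bump_deriv :: "real \<Rightarrow> real" where
  "bump_deriv s = - 2 * max 0 (1 - s)"

lemma bump_has_derivative: "(bump has_real_derivative bump_deriv s) (at s)"
proof -
  consider "s < 1" | "s = 1" | "s > 1"
    by linarith
  then show ?thesis
  proof cases
    case 1
    have "((\<lambda>s. (1 - s)\<^sup>2) has_real_derivative bump_deriv s) (at s)"
      using 1 by (auto intro!: derivative_eq_intros simp: bump_deriv_def)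
    then show ?thesis
      by (rule has_field_derivative_transform_within_open[where S = "{..<1}"]) (use 1 in \<open>auto simp: bump_def\<close>)
  next
    case 2
    have "((\<lambda>h. (bump (1 + h) - bump 1) / h) \<longlongrightarrow> 0) (at 0)"
    proof (rule Lim_null_comparison)
      show "\<forall>\<^sub>F h in at 0. norm ((bump (1 + h) - bump 1) / h) \<le> \<bar>h\<bar>"
        by (rule always_eventually) (auto simp: bump_def max_def power2_eq_square)
      show "((\<lambda>h::real. \<bar>h\<bar>) \<longlongrightarrow> 0) (at 0)"
        by (auto intro!: tendsto_eq_intros)
    qed
    then show ?thesis
      unfolding DERIV_def 2 bump_deriv_def by simp
  next
    case 3
    have "((\<lambda>s. 0) has_real_derivative bump_deriv s) (at s)"
      using 3 by (simp add: bump_deriv_def max_def)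
    then show ?thesis
      by (rule has_field_derivative_transform_within_open[where S = "{1<..}"]) (use 3 in \<open>auto simp: bump_def max_def\<close>)
  qed
qed

lemma continuous_on_bump_deriv: "continuous_on A bump_deriv"
  unfolding bump_deriv_def by (intro continuous_intros)

lemma continuous_on_bump: "continuous_on A bump"
  unfolding bump_def by (intro continuous_intros)

lemma bump_nonneg: "bump s \<ge> 0"
  by (simp add: bump_def)

lemma bump_le_1: "s \<ge> 0 \<Longrightarrow> bump s \<le> 1"
  unfolding bump_def by (intro power_le_one) auto

lemma abs_bump_deriv_le: "s \<ge> 0 \<Longrightarrow> \<bar>bump_deriv s\<bar> \<le> 2"
  by (auto simp: bump_deriv_def)

lemma bump_eq_0: "s \<ge> 1 \<Longrightarrow> bump s = 0" "s \<ge> 1 \<Longrightarrow> bump_deriv s = 0"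
  by (simp_all add: bump_def bump_deriv_def max_def)

lemma bump_ge: "s \<le> 1/4 \<Longrightarrow> bump s \<ge> 9/16"
  unfolding bump_def using power_mono[of "3/4" "max 0 (1 - s)" 2] by (simp add: power2_eq_square)

text \<open>For \<open>v = r\<^sup>2\<close> this is the position of \<open>ln r\<close> in the interval from \<open>- 6 n\<close> to \<open>- 2 n\<close>, normalised to
  the interval from \<open>- 1\<close> to \<open>1\<close>.\<close>

definition log_pos :: "real \<Rightarrow> real \<Rightarrow> real" where
  "log_pos n v = (ln v / 2 + 4 * n) / (2 * n)"

text \<open>The power \<open>r powr (- \<alpha>)\<close>, where \<open>v = r\<^sup>2\<close>, cut off slowly in \<open>ln r\<close> at both ends.\<close>

definition profile :: "real \<Rightarrow> real \<Rightarrow> real \<Rightarrow> real" where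
  "profile \<alpha> n v = bump ((log_pos n v)\<^sup>2) * v powr (- \<alpha> / 2)"

definition profile_deriv :: "real \<Rightarrow> real \<Rightarrow> real \<Rightarrow> real" where
  "profile_deriv \<alpha> n v = v powr (- \<alpha> / 2) / (2 * v) *
     (bump_deriv ((log_pos n v)\<^sup>2) * log_pos n v / n - \<alpha> * bump ((log_pos n v)\<^sup>2))"

lemma profile_has_derivative:
  assumes "v > 0" "n > 0"
  shows "(profile \<alpha> n has_real_derivative profile_deriv \<alpha> n v) (at v)"
proof -
  have "(log_pos n has_real_derivative 1 / (4 * n * v)) (at v)"
    unfolding log_pos_def[abs_def] using assms by (auto intro!: derivative_eq_intros simp: field_simps)
  then have "((\<lambda>v. (log_pos n v)\<^sup>2) has_real_derivative log_pos n v / (2 * n * v)) (at v)"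
    using assms by (auto intro!: derivative_eq_intros simp: field_simps)
  from DERIV_chain2[OF bump_has_derivative this]
  have bump: "((\<lambda>v. bump ((log_pos n v)\<^sup>2)) has_real_derivative
      bump_deriv ((log_pos n v)\<^sup>2) * (log_pos n v / (2 * n * v))) (at v)" .
  have pow: "((\<lambda>v. v powr (- \<alpha> / 2)) has_real_derivative (- \<alpha> / 2) * (v powr (- \<alpha> / 2) / v)) (at v)"
    using assms by (auto intro!: derivative_eq_intros simp: powr_diff)
  have "(profile \<alpha> n has_real_derivative
      bump_deriv ((log_pos n v)\<^sup>2) * (log_pos n v / (2 * n * v)) * v powr (- \<alpha> / 2)
      + (- \<alpha> / 2) * (v powr (- \<alpha> / 2) / v) * bump ((log_pos n v)\<^sup>2)) (at v)"
    unfolding profile_def[abs_def] by (rule DERIV_mult[OF bump pow])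
  also have "bump_deriv ((log_pos n v)\<^sup>2) * (log_pos n v / (2 * n * v)) * v powr (- \<alpha> / 2)
      + (- \<alpha> / 2) * (v powr (- \<alpha> / 2) / v) * bump ((log_pos n v)\<^sup>2) = profile_deriv \<alpha> n v"
    using assms unfolding profile_deriv_def by (simp add: field_simps)
  finally show ?thesis .
qed

lemma log_pos_sq_le_iff:
  assumes "v > 0" "n > 0"
  shows "(log_pos n v)\<^sup>2 \<le> 1 \<longleftrightarrow> exp (- (12 * n)) \<le> v \<and> v \<le> exp (- (4 * n))"
proof -
  have "(log_pos n v)\<^sup>2 \<le> 1 \<longleftrightarrow> - 1 \<le> log_pos n v \<and> log_pos n v \<le> 1"
    unfolding abs_le_square_iff[of _ 1, simplified, symmetric] abs_le_iff by auto
  also have "\<dots> \<longleftrightarrow> - (12 * n) \<le> ln v \<and> ln v \<le> - (4 * n)"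
    using assms by (auto simp: log_pos_def field_simps)
  also have "\<dots> \<longleftrightarrow> exp (- (12 * n)) \<le> v \<and> v \<le> exp (- (4 * n))"
    using assms exp_le_cancel_iff[of "- (12 * n)" "ln v"] exp_le_cancel_iff[of "ln v" "- (4 * n)"]
    by simp
  finally show ?thesis .
qed

lemma profile_eq_0:
  assumes "v \<ge> 0" "n > 0" "\<not> (exp (- (12 * n)) \<le> v \<and> v \<le> exp (- (4 * n)))"
  shows "profile \<alpha> n v = 0" "profile_deriv \<alpha> n v = 0"
proof -
  \<comment> \<open>at \<open>v = 0\<close> both functions vanish because \<open>0 powr a = 0\<close>\<close>
  have "v = 0 \<or> (log_pos n v)\<^sup>2 \<ge> 1"
    using assms log_pos_sq_le_iff[of v n] by linarith
  then show "profile \<alpha> n v = 0" "profile_deriv \<alpha> n v = 0"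
    by (auto simp: profile_def profile_deriv_def bump_eq_0)
qed

lemma continuous_on_profile:
  assumes "n > 0"
  shows "continuous_on {0<..} (profile \<alpha> n)" "continuous_on {0<..} (profile_deriv \<alpha> n)"
proof -
  have log: "continuous_on {0<..} (log_pos n)"
    unfolding log_pos_def using assms by (intro continuous_intros) auto
  then have sq: "continuous_on {0<..} (\<lambda>v. (log_pos n v)\<^sup>2)"
    by (intro continuous_intros)
  have "continuous_on {0<..} (\<lambda>v. bump ((log_pos n v)\<^sup>2))"
    by (rule continuous_on_compose2[OF continuous_on_bump[of UNIV] sq]) simp
  moreover have "continuous_on {0<..} (\<lambda>v. bump_deriv ((log_pos n v)\<^sup>2))"
    by (rule continuous_on_compose2[OF continuous_on_bump_deriv[of UNIV] sq]) simp
  ultimately show "continuous_on {0<..} (profile \<alpha> n)" "continuous_on {0<..} (profile_deriv \<alpha> n)"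
    unfolding profile_def profile_deriv_def using assms log by (auto intro!: continuous_intros)
qed

context convex_in_flat
begin

definition tang :: "'a \<Rightarrow> 'a" where
  "tang x = (\<Sum>b\<in>S. ((x - y) \<bullet> f b) *\<^sub>R f b)"

definition perp :: "'a \<Rightarrow> 'a" where
  "perp x = (\<Sum>b\<in>Basis - S. ((x - y) \<bullet> f b) *\<^sub>R f b)"

lemma norm_frame_sum_sq:
  assumes "T \<subseteq> Basis"
  shows "(norm (\<Sum>b\<in>T. c b *\<^sub>R f b))\<^sup>2 = (\<Sum>b\<in>T. (c b)\<^sup>2)"
proof -
  have "(\<Sum>b\<in>T. c b *\<^sub>R f b) \<bullet> f b = (if b \<in> T then c b else 0)" if "b \<in> Basis" for b
  proof -
    have "(\<Sum>b\<in>T. c b *\<^sub>R f b) \<bullet> f b = (\<Sum>i\<in>T. if i = b then c b else 0)"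
      unfolding inner_sum_left using frame assms that
      by (intro sum.cong) (auto simp: orthonormal_frame_def)
    then show ?thesis
      using finite_subset[OF assms] by simp
  qed
  then have "(norm (\<Sum>b\<in>T. c b *\<^sub>R f b))\<^sup>2 = (\<Sum>b\<in>Basis. (if b \<in> T then c b else 0)\<^sup>2)"
    unfolding power2_norm_eq_inner by (subst frame_inner[OF frame]) (simp add: power2_eq_square)
  also have "\<dots> = (\<Sum>b\<in>T. (c b)\<^sup>2)"
    using assms by (intro sum.mono_neutral_cong_right) auto
  finally show ?thesis .
qed

lemma norm_tang: "norm (tang x) = sqrt (tang_sq x)"
  using norm_frame_sum_sq[OF S_Basis, of "\<lambda>b. (x - y) \<bullet> f b"]
  unfolding tang_def tang_sq_def by (metis norm_ge_zero real_sqrt_unique)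

lemma norm_perp: "norm (perp x) = sqrt (perp_sq x)"
  using norm_frame_sum_sq[of "Basis - S" "\<lambda>b. (x - y) \<bullet> f b"]
  unfolding perp_def perp_sq_def by (metis Diff_subset norm_ge_zero real_sqrt_unique)

lemma frame_sum_sq_has_derivative:
  "((\<lambda>x. \<Sum>b\<in>T. ((x - y) \<bullet> f b)\<^sup>2) has_derivative
    (\<lambda>h. (2 *\<^sub>R (\<Sum>b\<in>T. ((x - y) \<bullet> f b) *\<^sub>R f b)) \<bullet> h)) (at x)"
proof -
  have "((\<lambda>x. ((x - y) \<bullet> f b)\<^sup>2) has_derivative (\<lambda>h. 2 * (((x - y) \<bullet> f b) * (f b \<bullet> h)))) (at x)" for b
    by (auto intro!: derivative_eq_intros simp: inner_commute[of "f b"])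
  then have "((\<lambda>x. \<Sum>b\<in>T. ((x - y) \<bullet> f b)\<^sup>2) has_derivative
      (\<lambda>h. \<Sum>b\<in>T. 2 * (((x - y) \<bullet> f b) * (f b \<bullet> h)))) (at x)"
    by (rule has_derivative_sum)
  then show ?thesis
    by (simp add: inner_sum_left sum_distrib_left)
qed

lemma tang_sq_has_derivative: "(tang_sq has_derivative (\<lambda>h. (2 *\<^sub>R tang x) \<bullet> h)) (at x)"
  unfolding tang_sq_def[abs_def] tang_def by (rule frame_sum_sq_has_derivative)

lemma perp_sq_has_derivative: "(perp_sq has_derivative (\<lambda>h. (2 *\<^sub>R perp x) \<bullet> h)) (at x)"
  unfolding perp_sq_def[abs_def] perp_def by (rule frame_sum_sq_has_derivative)

definition trial :: "real \<Rightarrow> nat \<Rightarrow> 'a \<Rightarrow> real" where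
  "trial \<alpha> n x = bump (tang_sq x / \<rho>\<^sup>2) * profile \<alpha> n (perp_sq x)"

definition trial_gradient :: "real \<Rightarrow> nat \<Rightarrow> 'a \<Rightarrow> 'a" where
  "trial_gradient \<alpha> n x =
     (bump_deriv (tang_sq x / \<rho>\<^sup>2) / \<rho>\<^sup>2 * profile \<alpha> n (perp_sq x)) *\<^sub>R (2 *\<^sub>R tang x)
   + (bump (tang_sq x / \<rho>\<^sup>2) * profile_deriv \<alpha> n (perp_sq x)) *\<^sub>R (2 *\<^sub>R perp x)"

text \<open>The support of the trial functions lies in the part of the neighbourhood of \<open>y\<close> where the
  logarithm of the distance from \<open>K\<close> is between \<open>- 6 n\<close> and \<open>- 2 n\<close>.\<close>

definition collar :: "nat \<Rightarrow> 'a set" where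
  "collar n = {x. tang_sq x \<le> \<rho>\<^sup>2 \<and> exp (- (12 * real n)) \<le> perp_sq x \<and> perp_sq x \<le> exp (- (4 * real n))}"

lemma compact_collar: "compact (collar n)"
proof -
  have "closed (collar n)"
    unfolding collar_def by (intro closed_Collect_conj closed_Collect_le continuous_intros)
  moreover have "bounded (collar n)"
  proof (rule boundedI)
    fix x assume x: "x \<in> collar n"
    have "exp (- (4 * real n)) \<le> 1"
      by simp
    then have "(norm (x - y))\<^sup>2 \<le> \<rho>\<^sup>2 + 1"
      using x unfolding norm_diff_sq collar_def mem_Collect_eq by linarith
    then have "norm (x - y) \<le> sqrt (\<rho>\<^sup>2 + 1)"
      by (rule real_le_rsqrt)
    then show "norm x \<le> norm y + sqrt (\<rho>\<^sup>2 + 1)"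
      using norm_triangle_sub[of x y] by linarith
  qed
  ultimately show ?thesis
    by (simp add: compact_eq_bounded_closed)
qed

lemma collar_perp_pos: "x \<in> collar n \<Longrightarrow> perp_sq x > 0"
  unfolding collar_def mem_Collect_eq using exp_gt_zero by (metis less_le_trans)

lemma collar_infdist: "x \<in> collar n \<Longrightarrow> infdist x K = sqrt (perp_sq x)"
  by (rule infdist_near_y) (simp add: collar_def)

lemma collar_disjoint: "collar n \<subseteq> - K"
  using collar_infdist collar_perp_pos by (metis ComplI less_irrefl infdist_zero real_sqrt_eq_zero_cancel_iff subsetI)

lemma trial_outside_collar:
  assumes "x \<notin> collar n" "n > 0"
  shows "trial \<alpha> n x = 0" "trial_gradient \<alpha> n x = 0"
proof -
  have "tang_sq x / \<rho>\<^sup>2 \<ge> 1 \<or> \<not> (exp (- (12 * real n)) \<le> perp_sq x \<and> perp_sq x \<le> exp (- (4 * real n)))"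
    using assms(1) \<rho>_pos by (auto simp: collar_def)
  then show "trial \<alpha> n x = 0" "trial_gradient \<alpha> n x = 0"
    using profile_eq_0[OF perp_sq_nonneg, of "real n" x \<alpha>] assms(2)
    by (auto simp: trial_def trial_gradient_def bump_eq_0)
qed

lemma trial_has_derivative:
  assumes n: "n > 0"
  shows "(trial \<alpha> n has_derivative (\<lambda>h. trial_gradient \<alpha> n x \<bullet> h)) (at x)"
proof (cases "perp_sq x > 0")
  case True
  have "((\<lambda>x. tang_sq x / \<rho>\<^sup>2) has_derivative (\<lambda>h. (2 *\<^sub>R tang x) \<bullet> h / \<rho>\<^sup>2)) (at x)"
    by (rule bounded_linear.has_derivative[OF bounded_linear_divide tang_sq_has_derivative])
  from has_derivative_compose[OF this bump_has_derivative[unfolded has_field_derivative_def]]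
  have bump: "((\<lambda>x. bump (tang_sq x / \<rho>\<^sup>2)) has_derivative
      (\<lambda>h. bump_deriv (tang_sq x / \<rho>\<^sup>2) * ((2 *\<^sub>R tang x) \<bullet> h / \<rho>\<^sup>2))) (at x)" .
  have prof: "((\<lambda>x. profile \<alpha> n (perp_sq x)) has_derivative
      (\<lambda>h. profile_deriv \<alpha> n (perp_sq x) * ((2 *\<^sub>R perp x) \<bullet> h))) (at x)"
    using True n by (intro has_derivative_compose[OF perp_sq_has_derivative
      profile_has_derivative[unfolded has_field_derivative_def]]) auto
  show ?thesis
    unfolding trial_def[abs_def]
    by (rule has_derivative_eq_rhs[OF has_derivative_mult[OF bump prof]])
      (simp add: trial_gradient_def fun_eq_iff inner_add_left)
next
  case False
  then have x: "x \<notin> collar n"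
    using collar_perp_pos by blast
  have const: "((\<lambda>x. 0) has_derivative (\<lambda>h. 0 \<bullet> h)) (at x)"
    by simp
  have "(trial \<alpha> n has_derivative (\<lambda>h. 0 \<bullet> h)) (at x)"
  proof (rule has_derivative_transform_within_open[OF const])
    show "open (- collar n)" "x \<in> - collar n"
      using x compact_collar by (auto simp: compact_imp_closed open_Compl)
    show "0 = trial \<alpha> n z" if "z \<in> - collar n" for z
      using trial_outside_collar(1)[of z n] that n by simp
  qed
  then show ?thesis
    using trial_outside_collar(2)[OF x n] by simp
qed

lemma trial_gradient_continuous:
  assumes n: "n > 0"
  shows "continuous_on UNIV (trial_gradient \<alpha> n)"
proof -
  let ?P = "{x. perp_sq x > 0}"
  have tp: "continuous_on A tang" "continuous_on A perp" for A
    unfolding tang_def perp_def by (intro continuous_intros)+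
  have prof: "continuous_on ?P (\<lambda>x. profile \<alpha> n (perp_sq x))"
    "continuous_on ?P (\<lambda>x. profile_deriv \<alpha> n (perp_sq x))"
    using n by (auto intro!: continuous_on_compose2[OF continuous_on_profile(1)]
      continuous_on_compose2[OF continuous_on_profile(2)] continuous_intros)
  have "continuous_on A (\<lambda>x. bump (tang_sq x / \<rho>\<^sup>2))" "continuous_on A (\<lambda>x. bump_deriv (tang_sq x / \<rho>\<^sup>2))" for A
    using \<rho>_pos by (intro continuous_on_compose2[OF continuous_on_bump[of UNIV]]
      continuous_on_compose2[OF continuous_on_bump_deriv[of UNIV]] continuous_intros subset_UNIV; simp)+
  then have "continuous_on ?P (trial_gradient \<alpha> n)"
    unfolding trial_gradient_def using tp prof \<rho>_pos by (intro continuous_intros) auto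
  moreover have "continuous_on (- collar n) (trial_gradient \<alpha> n)"
    using trial_outside_collar(2) n by (intro continuous_on_eq[OF continuous_on_const[of _ 0]]) auto
  moreover have "open ?P" "open (- collar n)"
    using compact_collar by (auto intro!: open_Collect_less continuous_intros simp: compact_imp_closed open_Compl)
  ultimately have "continuous_on (?P \<union> - collar n) (trial_gradient \<alpha> n)"
    by (intro continuous_on_open_Un)
  moreover have "?P \<union> - collar n = UNIV"
    using collar_perp_pos by blast
  ultimately show ?thesis
    by simp
qed

lemma trial_C1:
  assumes "n > 0"
  shows "trial \<alpha> n \<in> C1_compact_support (- K)" "gradient (trial \<alpha> n) x = trial_gradient \<alpha> n x"
  by (rule C1_compact_supportI[OF trial_has_derivative[OF assms] trial_gradient_continuous[OF assms]
        compact_collar collar_disjoint trial_outside_collar(1)[OF _ assms]]; assumption)+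

definition cutoff :: "nat \<Rightarrow> 'a \<Rightarrow> real" where
  "cutoff n x = bump (tang_sq x / \<rho>\<^sup>2) * bump ((log_pos n (perp_sq x))\<^sup>2)"

lemma cutoff_nonneg: "cutoff n x \<ge> 0"
  by (simp add: cutoff_def bump_nonneg)

lemma trial_eq:
  "x \<in> collar n \<Longrightarrow> trial \<alpha> n x = cutoff n x * infdist x K powr (- \<alpha>)"
proof -
  assume x: "x \<in> collar n"
  have "sqrt (perp_sq x) powr (- \<alpha>) = perp_sq x powr (- \<alpha> / 2)"
    using collar_perp_pos[OF x] by (simp add: powr_half_sqrt[symmetric] powr_powr)
  then show ?thesis
    by (simp add: trial_def cutoff_def profile_def collar_infdist[OF x])
qed

lemma collar_infdist_le:
  assumes "x \<in> collar n" "n > 0"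
  shows "infdist x K \<le> 1 / real n" "infdist x K \<le> 1"
proof -
  have "perp_sq x \<le> exp (- (2 * real n)) ^ 2"
    using assms(1) by (simp add: collar_def flip: exp_of_nat_mult)
  then have le: "infdist x K \<le> exp (- (2 * real n))"
    unfolding collar_infdist[OF assms(1)] by (simp add: real_le_lsqrt)
  have "1 + 2 * real n \<le> exp (2 * real n)"
    by (rule exp_ge_add_one_self)
  then have "real n \<le> exp (2 * real n)"
    by linarith
  then have "exp (- (2 * real n)) \<le> 1 / real n"
    using assms(2) by (simp add: exp_minus field_simps)
  with le show "infdist x K \<le> 1 / real n"
    by linarith
  show "infdist x K \<le> 1"
    using le by (rule order_trans) simp
qed

text \<open>With \<open>r\<close> for the distance, the cutoff along the flat costs \<open>r powr (- \<alpha>)\<close> up to a constant, and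
  \<open>r \<le> 1 / n\<close> on the collar.  The cutoff across the flat extends over an interval of length \<open>4 n\<close> in
  \<open>ln r\<close>, so it costs \<open>r powr (- \<alpha> - 1)\<close> times a multiple of \<open>1 / n\<close>.\<close>

lemma norm_trial_gradient_le:
  assumes x: "x \<in> collar n" and n: "n > 0" and \<alpha>: "\<alpha> \<ge> 0"
  shows "norm (trial_gradient \<alpha> n x)
    \<le> infdist x K powr (- \<alpha> - 1) * (\<alpha> * cutoff n x + (2 + 4 / \<rho>) / real n)"
proof -
  define r where "r = infdist x K"
  define q where "q = log_pos n (perp_sq x)"
  define s where "s = tang_sq x / \<rho>\<^sup>2"
  have v: "perp_sq x > 0" and r: "r = sqrt (perp_sq x)"
    using collar_perp_pos[OF x] collar_infdist[OF x] by (simp_all add: r_def)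
  have r_pos: "r > 0" and v_eq: "perp_sq x = r\<^sup>2"
    using v by (simp_all add: r)
  have v_powr: "perp_sq x powr (- \<alpha> / 2) = r powr (- \<alpha>)"
    unfolding r using v by (simp add: powr_half_sqrt[symmetric] powr_powr)
  then have v_powr': "perp_sq x powr - (\<alpha> / 2) = r powr (- \<alpha>)"
    by simp
  have q2: "q\<^sup>2 \<le> 1"
    unfolding q_def using x n v by (subst log_pos_sq_le_iff) (auto simp: collar_def)
  then have q: "\<bar>q\<bar> \<le> 1"
    by (simp add: abs_square_le_1)
  have s: "s \<ge> 0"
    by (simp add: s_def tang_sq_nonneg)
  have tang: "norm (tang x) \<le> \<rho>"
    using x \<rho>_pos unfolding norm_tang by (intro real_le_lsqrt) (auto simp: collar_def)
  have perp: "norm (perp x) = r"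
    by (simp add: norm_perp r)
  have "norm ((bump_deriv s / \<rho>\<^sup>2 * profile \<alpha> n (perp_sq x)) *\<^sub>R (2 *\<^sub>R tang x))
      = \<bar>bump_deriv s\<bar> * (bump (q\<^sup>2) * r powr (- \<alpha>)) * (2 * norm (tang x)) / \<rho>\<^sup>2"
    using \<rho>_pos by (simp add: profile_def q_def v_powr' abs_mult bump_nonneg)
  also have "\<dots> \<le> 2 * (1 * r powr (- \<alpha>)) * (2 * \<rho>) / \<rho>\<^sup>2"
    using abs_bump_deriv_le[OF s] tang \<rho>_pos
    by (intro divide_right_mono mult_mono bump_le_1) (auto simp: bump_nonneg)
  also have "\<dots> = r powr (- \<alpha> - 1) * (4 / \<rho> * r)"
    using \<rho>_pos r_pos by (simp add: powr_diff field_simps power2_eq_square)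
  also have "\<dots> \<le> r powr (- \<alpha> - 1) * (4 / \<rho> * (1 / real n))"
    using collar_infdist_le(1)[OF x n] \<rho>_pos by (intro mult_left_mono) (auto simp: r_def)
  finally have first: "norm ((bump_deriv s / \<rho>\<^sup>2 * profile \<alpha> n (perp_sq x)) *\<^sub>R (2 *\<^sub>R tang x))
      \<le> r powr (- \<alpha> - 1) * (4 / \<rho> * (1 / real n))" .
  have "\<bar>bump_deriv (q\<^sup>2) * q / real n\<bar> \<le> 2 * 1 / real n"
    unfolding abs_divide abs_mult using abs_bump_deriv_le[of "q\<^sup>2"] q n
    by (intro frac_le mult_mono) auto
  then have "\<bar>bump_deriv (q\<^sup>2) * q / real n - \<alpha> * bump (q\<^sup>2)\<bar> \<le> 2 / real n + \<alpha> * bump (q\<^sup>2)"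
    using abs_triangle_ineq4[of "bump_deriv (q\<^sup>2) * q / real n" "\<alpha> * bump (q\<^sup>2)"]
      abs_of_nonneg[OF mult_nonneg_nonneg[OF \<alpha> bump_nonneg[of "q\<^sup>2"]]] by linarith
  then have "bump s * \<bar>bump_deriv (q\<^sup>2) * q / real n - \<alpha> * bump (q\<^sup>2)\<bar>
      \<le> bump s * (2 / real n + \<alpha> * bump (q\<^sup>2))"
    by (rule mult_left_mono) (rule bump_nonneg)
  also have "\<dots> \<le> 2 / real n + \<alpha> * (bump s * bump (q\<^sup>2))"
    using mult_right_mono[OF bump_le_1[OF s], of "2 / real n"] by (simp add: algebra_simps)
  finally have "bump s * \<bar>bump_deriv (q\<^sup>2) * q / real n - \<alpha> * bump (q\<^sup>2)\<bar>
      \<le> 2 / real n + \<alpha> * cutoff n x"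
    by (simp add: cutoff_def s_def q_def)
  then have "r powr (- \<alpha> - 1) * (bump s * \<bar>bump_deriv (q\<^sup>2) * q / real n - \<alpha> * bump (q\<^sup>2)\<bar>)
      \<le> r powr (- \<alpha> - 1) * (2 / real n + \<alpha> * cutoff n x)"
    by (rule mult_left_mono) simp
  moreover have "norm ((bump s * profile_deriv \<alpha> n (perp_sq x)) *\<^sub>R (2 *\<^sub>R perp x))
      = r powr (- \<alpha> - 1) * (bump s * \<bar>bump_deriv (q\<^sup>2) * q / real n - \<alpha> * bump (q\<^sup>2)\<bar>)"
  proof -
    define X where "X = bump_deriv (q\<^sup>2) * q / real n - \<alpha> * bump (q\<^sup>2)"
    have "profile_deriv \<alpha> n (perp_sq x) = r powr (- \<alpha>) / (2 * r\<^sup>2) * X"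
      unfolding profile_deriv_def v_powr q_def[symmetric] X_def by (simp only: v_eq)
    then have "norm ((bump s * profile_deriv \<alpha> n (perp_sq x)) *\<^sub>R (2 *\<^sub>R perp x))
        = bump s * (r powr (- \<alpha>) / (2 * r\<^sup>2) * \<bar>X\<bar>) * (2 * r)"
      by (simp add: perp abs_mult bump_nonneg)
    also have "\<dots> = r powr (- \<alpha> - 1) * (bump s * \<bar>X\<bar>)"
      using r_pos by (simp add: powr_diff power2_eq_square)
    finally show ?thesis
      by (simp only: X_def)
  qed
  ultimately have second: "norm ((bump s * profile_deriv \<alpha> n (perp_sq x)) *\<^sub>R (2 *\<^sub>R perp x))
      \<le> r powr (- \<alpha> - 1) * (2 / real n + \<alpha> * cutoff n x)"
    by simp
  have "norm (trial_gradient \<alpha> n x) \<le> r powr (- \<alpha> - 1) * (4 / \<rho> * (1 / real n))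
      + r powr (- \<alpha> - 1) * (2 / real n + \<alpha> * cutoff n x)"
    unfolding trial_gradient_def s_def[symmetric] by (rule norm_triangle_mono[OF first second])
  also have "\<dots> = r powr (- \<alpha> - 1) * (\<alpha> * cutoff n x + (2 + 4 / \<rho>) / real n)"
    by (simp add: algebra_simps add_divide_distrib)
  finally show ?thesis
    by (simp add: r_def)
qed

end

section \<open>Hardy quotients of the trial functions\<close>

context convex_in_flat
begin

lemma shell_powr_bounds:
  assumes "x \<in> shell R j"
  shows "exp (real j) ^ codim \<le> sqrt (perp_sq x) powr (- real codim)"
    "sqrt (perp_sq x) powr (- real codim) \<le> exp (real (Suc j)) ^ codim"
proof -
  define r where "r = sqrt (perp_sq x)"
  have v: "exp (- (2 * (real j + 1))) < perp_sq x" "perp_sq x \<le> exp (- (2 * real j))"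
    using assms by (simp_all add: shell_def)
  have "exp (- (real j + 1)) ^ 2 \<le> perp_sq x" "perp_sq x \<le> exp (- real j) ^ 2"
    using v by (simp_all add: algebra_simps flip: exp_of_nat_mult)
  then have r: "exp (- (real j + 1)) \<le> r" "r \<le> exp (- real j)"
    unfolding r_def by (auto intro: real_le_rsqrt real_le_lsqrt)
  have r_pos: "r > 0"
    using r(1) exp_gt_zero by (rule less_le_trans[rotated])
  have exp_powr: "exp (- t) powr (- real codim) = exp t ^ codim" for t :: real
    by (simp add: exp_powr_real exp_of_nat_mult flip: exp_of_nat2_mult)
  have "exp (- real j) powr (- real codim) \<le> r powr (- real codim)"
    using r(2) r_pos by (intro powr_mono2') auto
  then show "exp (real j) ^ codim \<le> sqrt (perp_sq x) powr (- real codim)"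
    by (simp only: exp_powr r_def)
  have "r powr (- real codim) \<le> exp (- (real j + 1)) powr (- real codim)"
    using r(1) r_pos by (intro powr_mono2') auto
  then show "sqrt (perp_sq x) powr (- real codim) \<le> exp (real (Suc j)) ^ codim"
    by (simp only: exp_powr r_def of_nat_Suc add.commute)
qed

lemma shell_disjoint:
  assumes "x \<in> shell R i" "x \<in> shell R j"
  shows "i = j"
proof -
  have "exp (- (2 * (real i + 1))) < exp (- (2 * real j))" "exp (- (2 * (real j + 1))) < exp (- (2 * real i))"
    using assms unfolding shell_def mem_Collect_eq by linarith+
  then show ?thesis
    by simp
qed

lemma collar_in_shell:
  assumes x: "x \<in> collar n"
  obtains j where "j \<in> {2 * n..6 * n}" "x \<in> shell (\<rho>\<^sup>2) j"
proof -
  define t where "t = - ln (perp_sq x) / 2"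
  have v: "perp_sq x > 0"
    using x by (rule collar_perp_pos)
  have "exp (- (12 * real n)) \<le> perp_sq x" "perp_sq x \<le> exp (- (4 * real n))"
    using x by (simp_all add: collar_def)
  then have "- (12 * real n) \<le> ln (perp_sq x)" "ln (perp_sq x) \<le> - (4 * real n)"
    using v exp_le_cancel_iff[of "- (12 * real n)" "ln (perp_sq x)"]
      exp_le_cancel_iff[of "ln (perp_sq x)" "- (4 * real n)"] by simp_all
  then have t: "2 * real n \<le> t" "t \<le> 6 * real n"
    by (simp_all add: t_def)
  define j where "j = nat \<lfloor>t\<rfloor>"
  have j: "real j \<le> t" "t < real j + 1"
    using t(1) unfolding j_def by linarith+
  have "perp_sq x = exp (- (2 * t))"
    using v by (simp add: t_def)
  then have "x \<in> shell (\<rho>\<^sup>2) j"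
    using x j by (simp add: shell_def collar_def)
  moreover have "j \<in> {2 * n..6 * n}"
  proof -
    have "real (2 * n) < real (j + 1)" "real j \<le> real (6 * n)"
      using t j by simp_all
    then show ?thesis
      unfolding of_nat_less_iff of_nat_le_iff by simp
  qed
  ultimately show ?thesis
    using that by blast
qed

lemma integrable_shell_indicator: "integrable lborel (\<lambda>x. c * indicat_real (shell R j) x)"
  using emeasure_shell_finite[of R j] by (intro integrable_mult_right integrable_real_indicator) auto

lemma integral_shell_indicator:
  "(\<integral>x. c * indicat_real (shell R j) x \<partial>lborel) = c * (exp (- real j) ^ codim * measure lborel (shell R 0))"
  using measure_shell[of R j] by simp

text \<open>The collar meets \<open>4 n + 1\<close> shells.  In the shell with index \<open>j\<close> the integrand is at most
  \<open>exp (j + 1) ^ codim\<close>, and the volume is a fixed multiple of \<open>exp (- j) ^ codim\<close>, so all shells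
  contribute the same bound.\<close>

lemma collar_integral_le:
  assumes n: "n > 0"
  shows "integrable lborel (\<lambda>x. indicator (collar n) x * sqrt (perp_sq x) powr (- real codim))" (is "integrable lborel ?F")
    and "(\<integral>x. indicator (collar n) x * sqrt (perp_sq x) powr (- real codim) \<partial>lborel)
      \<le> 5 * real n * (exp 1 ^ codim * measure lborel (shell (\<rho>\<^sup>2) 0))"
proof -
  let ?J = "{2 * n..6 * n}"
  let ?G = "\<lambda>x. \<Sum>j\<in>?J. exp (real (Suc j)) ^ codim * indicat_real (shell (\<rho>\<^sup>2) j) x"
  show int: "integrable lborel ?F"
  proof (rule integrable_compact_support[OF compact_collar])
    have "continuous_on (collar n) (\<lambda>x. sqrt (perp_sq x) powr (- real codim))"
      using collar_perp_pos by (intro continuous_intros) fastforce+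
    then show "continuous_on (collar n) ?F"
      by (rule continuous_on_eq) simp
  qed simp
  have "(\<integral>x. ?F x \<partial>lborel) \<le> (\<integral>x. ?G x \<partial>lborel)"
  proof (intro integral_mono int Bochner_Integration.integrable_sum integrable_shell_indicator)
    fix x
    show "?F x \<le> ?G x"
    proof (cases "x \<in> collar n")
      case True
      then obtain j where j: "j \<in> ?J" "x \<in> shell (\<rho>\<^sup>2) j"
        by (rule collar_in_shell)
      have "?F x \<le> exp (real (Suc j)) ^ codim * indicat_real (shell (\<rho>\<^sup>2) j) x"
        using True j(2) shell_powr_bounds(2)[OF j(2)] by simp
      also have "\<dots> \<le> ?G x"
        using j(1) by (intro member_le_sum[of j ?J "\<lambda>j. exp (real (Suc j)) ^ codim * indicat_real (shell (\<rho>\<^sup>2) j) x"]) auto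
      finally show ?thesis .
    next
      case False
      then show ?thesis
        by (simp add: sum_nonneg)
    qed
  qed
  also have "\<dots> = (\<Sum>j\<in>?J. exp (real (Suc j)) ^ codim * (exp (- real j) ^ codim * measure lborel (shell (\<rho>\<^sup>2) 0)))"
    by (subst Bochner_Integration.integral_sum[OF integrable_shell_indicator])
      (simp only: integral_shell_indicator)
  also have "\<dots> = (\<Sum>j\<in>?J. exp 1 ^ codim * measure lborel (shell (\<rho>\<^sup>2) 0))"
    by (intro sum.cong refl) (simp add: mult.assoc[symmetric] power_mult_distrib[symmetric] flip: exp_add)
  also have "\<dots> = real (4 * n + 1) * (exp 1 ^ codim * measure lborel (shell (\<rho>\<^sup>2) 0))"
    by simp
  also have "\<dots> \<le> 5 * real n * (exp 1 ^ codim * measure lborel (shell (\<rho>\<^sup>2) 0))"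
    using n by (intro mult_right_mono) auto
  finally show "(\<integral>x. ?F x \<partial>lborel) \<le> 5 * real n * (exp 1 ^ codim * measure lborel (shell (\<rho>\<^sup>2) 0))" .
qed

text \<open>In each of the \<open>2 n\<close> disjoint middle shells the density \<open>exp j ^ codim\<close> compensates the volume.\<close>

lemma integral_ge_shells:
  assumes int: "integrable lborel F" and nonneg: "\<And>x. F x \<ge> 0" and c: "c \<ge> 0"
    and lower: "\<And>x j. j \<in> {3 * n..<5 * n} \<Longrightarrow> x \<in> shell R j \<Longrightarrow>
      c * sqrt (perp_sq x) powr (- real codim) \<le> F x"
  shows "2 * real n * (c * measure lborel (shell R 0)) \<le> (\<integral>x. F x \<partial>lborel)"
proof -
  let ?J = "{3 * n..<5 * n}"
  let ?G = "\<lambda>x. \<Sum>j\<in>?J. c * exp (real j) ^ codim * indicat_real (shell R j) x"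
  have "2 * real n * (c * measure lborel (shell R 0))
      = (\<Sum>j\<in>?J. c * measure lborel (shell R 0))"
    by simp
  also have "\<dots> = (\<Sum>j\<in>?J. c * exp (real j) ^ codim * (exp (- real j) ^ codim * measure lborel (shell R 0)))"
    by (intro sum.cong refl) (simp add: mult.assoc[symmetric] power_mult_distrib[symmetric] mult.assoc[of c] flip: exp_add)
  also have "\<dots> = (\<integral>x. ?G x \<partial>lborel)"
    by (subst Bochner_Integration.integral_sum[OF integrable_shell_indicator])
      (simp only: integral_shell_indicator)
  also have "\<dots> \<le> (\<integral>x. F x \<partial>lborel)"
  proof (intro integral_mono int Bochner_Integration.integrable_sum integrable_shell_indicator)
    fix x
    show "?G x \<le> F x"
    proof (cases "\<exists>j\<in>?J. x \<in> shell R j")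
      case True
      then obtain j where j: "j \<in> ?J" "x \<in> shell R j"
        by blast
      have "x \<in> shell R i \<longleftrightarrow> i = j" for i
        using shell_disjoint j(2) by blast
      then have "?G x = (\<Sum>i\<in>?J. if i = j then c * exp (real j) ^ codim else 0)"
        by (intro sum.cong) (simp_all add: indicator_def)
      also have "\<dots> = c * exp (real j) ^ codim"
        using j(1) by simp
      also have "\<dots> \<le> c * sqrt (perp_sq x) powr (- real codim)"
        by (intro mult_left_mono shell_powr_bounds(1)[OF j(2)] c)
      also have "\<dots> \<le> F x"
        using j by (rule lower)
      finally show ?thesis .
    next
      case False
      then have "?G x = 0"
        by (intro sum.neutral) auto
      then show ?thesis
        using nonneg by simp
    qed
  qed
  finally show ?thesis .
qed

text \<open>In the middle half of the range of \<open>ln r\<close> the normalised position is at most \<open>1/2\<close> in absolute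
  value, so both cutoffs are at least \<open>bump (1/4)\<close>.\<close>

lemma cutoff_ge_in_middle_shell:
  assumes j: "j \<in> {3 * n..<5 * n}" and x: "x \<in> shell (\<rho>\<^sup>2 / 4) j"
  shows "x \<in> collar n" "cutoff n x \<ge> (9/16) * (9/16)"
proof -
  have n: "n > 0"
    using j by (cases n) auto
  have j': "real (3 * n) \<le> real j" "real (j + 1) \<le> real (5 * n)"
    using j unfolding of_nat_le_iff by auto
  have v: "exp (- (2 * (real j + 1))) < perp_sq x" "perp_sq x \<le> exp (- (2 * real j))"
      and u: "tang_sq x \<le> \<rho>\<^sup>2 / 4"
    using x by (simp_all add: shell_def)
  have pos: "perp_sq x > 0"
    using v(1) exp_gt_zero less_trans by blast
  have ln: "- (2 * (real j + 1)) \<le> ln (perp_sq x)" "ln (perp_sq x) \<le> - (2 * real j)"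
    using pos v exp_le_cancel_iff[of "- (2 * (real j + 1))" "ln (perp_sq x)"]
      exp_le_cancel_iff[of "ln (perp_sq x)" "- (2 * real j)"] by simp_all
  then have "- (10 * real n) \<le> ln (perp_sq x)" "ln (perp_sq x) \<le> - (6 * real n)"
    using j' by simp_all
  then have "- (1/2) \<le> log_pos n (perp_sq x)" "log_pos n (perp_sq x) \<le> 1/2"
    using n by (simp_all add: log_pos_def field_simps)
  then have "\<bar>log_pos n (perp_sq x)\<bar> \<le> \<bar>1/2\<bar>"
    by (simp add: abs_le_iff)
  then have "(log_pos n (perp_sq x))\<^sup>2 \<le> (1/2)\<^sup>2"
    by (simp only: abs_le_square_iff)
  then have sq: "(log_pos n (perp_sq x))\<^sup>2 \<le> 1/4"
    by (simp add: power2_eq_square)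
  have "tang_sq x / \<rho>\<^sup>2 \<le> 1/4"
    using u \<rho>_pos by (simp add: field_simps)
  then show "cutoff n x \<ge> (9/16) * (9/16)"
    unfolding cutoff_def using sq by (intro mult_mono bump_ge) (auto simp: bump_nonneg)
  have "(log_pos n (perp_sq x))\<^sup>2 \<le> 1"
    using sq by simp
  moreover have "tang_sq x \<le> \<rho>\<^sup>2"
    using u by (rule order_trans) simp
  ultimately show "x \<in> collar n"
    using n log_pos_sq_le_iff[OF pos, of "real n"] by (simp add: collar_def)
qed

text \<open>On the collar both integrands are \<open>d powr (- codim) * (1 + d) powr (\<delta>' - \<delta>)\<close> times a power of the
  cutoff and a constant, except for the errors in the gradient.  Since \<open>d \<le> 1\<close> there, the second factor lies between
  \<open>1 / L\<close> and \<open>L\<close>.  The main part of the numerator is at most \<open>(1 + \<eta>) powr p * \<alpha> powr p\<close> times the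
  denominator.  The errors contribute at most a constant times \<open>n * (1 / n) powr p\<close>, which is bounded
  because \<open>p \<ge> 1\<close>, whereas the denominator grows at least like \<open>n\<close>.\<close>

theorem near_optimal_trial:
  assumes p: "p \<ge> 1" and codim: "codim > 0" and pos: "real codim + \<delta> - p > 0"
    and c: "c > ((real codim + \<delta> - p) / p) powr p"
  obtains \<phi> where "\<phi> \<in> C1_compact_support (- K)"
    "(\<integral>x. weight \<delta> \<delta>' (infdist x K) * infdist x K powr (- p) * \<bar>\<phi> x\<bar> powr p \<partial>lborel) > 0"
    "(\<integral>x. weight \<delta> \<delta>' (infdist x K) * grad_norm \<phi> x powr p \<partial>lborel)
      \<le> c * (\<integral>x. weight \<delta> \<delta>' (infdist x K) * infdist x K powr (- p) * \<bar>\<phi> x\<bar> powr p \<partial>lborel)"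
proof -
  define \<alpha> where "\<alpha> = (real codim + \<delta> - p) / p"
  have \<alpha>: "\<alpha> > 0" "p * \<alpha> = real codim + \<delta> - p"
    using pos p by (simp_all add: \<alpha>_def)
  define d where "d x = infdist x K" for x
  define L where "L = 2 powr \<bar>\<delta>' - \<delta>\<bar>"
  have L: "L > 0"
    by (simp add: L_def)
  have L_bounds: "(1 + t) powr (\<delta>' - \<delta>) \<le> L" "1 / L \<le> (1 + t) powr (\<delta>' - \<delta>)" if "0 \<le> t" "t \<le> 1" for t
  proof -
    have "(1 + t) powr e \<le> 2 powr \<bar>e\<bar>" for e
    proof -
      have "(1 + t) powr e \<le> (1 + t) powr \<bar>e\<bar>"
        using that by (intro powr_mono) auto
      also have "\<dots> \<le> 2 powr \<bar>e\<bar>"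
        using that by (intro powr_mono2) auto
      finally show ?thesis .
    qed
    from this[of "\<delta>' - \<delta>"] this[of "\<delta> - \<delta>'"]
    have "(1 + t) powr (\<delta>' - \<delta>) \<le> L" "(1 + t) powr (\<delta> - \<delta>') \<le> L"
      by (simp_all add: L_def abs_minus_commute)
    then show "(1 + t) powr (\<delta>' - \<delta>) \<le> L" "1 / L \<le> (1 + t) powr (\<delta>' - \<delta>)"
      using powr_minus_divide[of "1 + t" "\<delta> - \<delta>'"] that L by (auto intro: frac_le)
  qed
  have weight_powr: "weight \<delta> \<delta>' t * t powr (- p * (\<alpha> + 1)) = t powr (- real codim) * (1 + t) powr (\<delta>' - \<delta>)"
    if "t > 0" for t
  proof -
    have "t powr \<delta> * t powr (- p * (\<alpha> + 1)) = t powr (- real codim)"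
      using \<alpha>(2) by (simp add: algebra_simps flip: powr_add)
    then show ?thesis
      by (simp add: weight_def mult_ac)
  qed
  obtain \<eta> where \<eta>: "\<eta> > 0" "(1 + \<eta>) powr p * \<alpha> powr p < c"
  proof -
    have "((\<lambda>\<eta>. (1 + \<eta>) powr p * \<alpha> powr p) \<longlongrightarrow> (1 + 0) powr p * \<alpha> powr p) (at_right 0)"
      by (intro tendsto_intros) auto
    then have "\<forall>\<^sub>F \<eta> in at_right 0. (1 + \<eta>) powr p * \<alpha> powr p < c"
      using c by (intro order_tendstoD(2)) (auto simp: \<alpha>_def)
    then have "\<forall>\<^sub>F \<eta> in at_right 0. 0 < \<eta> \<and> (1 + \<eta>) powr p * \<alpha> powr p < c"
      using eventually_at_right_less by (rule eventually_elim2) auto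
    then show thesis
      using that eventually_happens'[OF trivial_limit_at_right_real] by blast
  qed
  define M where "M = 2 + 4 / \<rho>"
  have M: "M > 0"
    using \<rho>_pos by (simp add: M_def add_pos_pos)
  define V where "V = exp 1 ^ codim * measure lborel (shell (\<rho>\<^sup>2) 0)"
  \<comment> \<open>\<open>(9/16) * (9/16)\<close> is the lower bound for the cutoff in the middle shells\<close>
  define v where "v = ((9/16) * (9/16)) powr p / L * measure lborel (shell (\<rho>\<^sup>2 / 4) 0)"
  have v: "v > 0"
    unfolding v_def using L codim \<rho>_pos by (intro mult_pos_pos divide_pos_pos measure_shell_pos) auto
  define B where "B = (1 + 1 / \<eta>) powr p * M powr p * L * (5 * V)"
  have B: "B \<ge> 0"
    unfolding B_def V_def using L by (intro mult_nonneg_nonneg) auto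
  define gap where "gap = c - (1 + \<eta>) powr p * \<alpha> powr p"
  have gap: "gap > 0"
    using \<eta> by (simp add: gap_def)
  obtain n :: nat where n: "n > 0" "B / real n \<le> gap * (2 * v)"
  proof -
    obtain n :: nat where "B / (gap * (2 * v)) < real n"
      using reals_Archimedean2 by blast
    moreover from this have "n > 0"
      using B gap v by (cases n) (auto simp: divide_less_0_iff mult_less_0_iff)
    ultimately show thesis
      using that[of n] gap v by (simp add: field_simps)
  qed
  define \<phi> where "\<phi> = trial \<alpha> n"
  note \<phi>C = trial_C1[OF n(1), of \<alpha>, folded \<phi>_def]
  define N where "N x = weight \<delta> \<delta>' (d x) * grad_norm \<phi> x powr p" for x
  define Q where "Q x = weight \<delta> \<delta>' (d x) * d x powr (- p) * \<bar>\<phi> x\<bar> powr p" for x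
  define W where "W x = indicator (collar n) x * sqrt (perp_sq x) powr (- real codim)" for x
  have outside: "N x = 0" "Q x = 0" "W x = 0" if "x \<notin> collar n" for x
    using trial_outside_collar[OF that n(1), of \<alpha>] \<phi>C
    by (simp_all add: N_def Q_def W_def grad_norm_eq \<phi>_def[symmetric] that)
  have d_pos: "d x > 0" and d_le: "d x \<le> 1" and d_eq: "d x = sqrt (perp_sq x)" if "x \<in> collar n" for x
    using collar_perp_pos[OF that] collar_infdist[OF that] collar_infdist_le(2)[OF that n(1)]
    by (simp_all add: d_def)
  have cont_weight: "continuous_on (collar n) (\<lambda>x. weight \<delta> \<delta>' (d x))"
    unfolding weight_def d_def
    by (intro continuous_intros) (use d_pos in \<open>fastforce simp: d_def\<close>)+
  have int_N: "integrable lborel N"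
  proof (rule integrable_compact_support[OF compact_collar _ outside(1)])
    show "continuous_on (collar n) N"
      unfolding N_def grad_norm_eq using p C1_compact_supportD(5)[OF \<phi>C(1)]
      by (intro continuous_intros cont_weight continuous_on_powr') auto
  qed
  have int_Q: "integrable lborel Q"
  proof (rule integrable_compact_support[OF compact_collar _ outside(2)])
    have "continuous_on (collar n) (\<lambda>x. d x powr (- p))"
      unfolding d_def by (intro continuous_intros) (use d_pos in \<open>fastforce simp: d_def\<close>)
    moreover have "continuous_on (collar n) (\<lambda>x. \<bar>\<phi> x\<bar> powr p)"
      using p C1_compact_supportD(4)[OF \<phi>C(1)] by (intro continuous_intros continuous_on_powr') auto
    ultimately show "continuous_on (collar n) Q"
      unfolding Q_def by (intro continuous_on_mult cont_weight)
  qed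
  have int_W: "integrable lborel W" and W_le: "(\<integral>x. W x \<partial>lborel) \<le> 5 * real n * V"
    using collar_integral_le[OF n(1)] by (simp_all add: W_def[abs_def] V_def)
  have Q_eq: "Q x = W x * (1 + d x) powr (\<delta>' - \<delta>) * cutoff n x powr p" if x: "x \<in> collar n" for x
  proof -
    have "\<bar>\<phi> x\<bar> = cutoff n x * d x powr (- \<alpha>)"
      unfolding \<phi>_def trial_eq[OF x] d_def[symmetric] by (simp add: abs_mult cutoff_nonneg)
    then have "\<bar>\<phi> x\<bar> powr p = cutoff n x powr p * d x powr (- p * \<alpha>)"
      by (simp add: powr_mult powr_powr cutoff_nonneg mult.commute[of \<alpha> p])
    then have "Q x = (weight \<delta> \<delta>' (d x) * (d x powr (- p) * d x powr (- p * \<alpha>))) * cutoff n x powr p"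
      by (simp only: Q_def mult_ac)
    also have "d x powr (- p) * d x powr (- p * \<alpha>) = d x powr (- p * (\<alpha> + 1))"
      unfolding powr_add[symmetric] by (simp add: algebra_simps)
    also have "weight \<delta> \<delta>' (d x) * d x powr (- p * (\<alpha> + 1)) = W x * (1 + d x) powr (\<delta>' - \<delta>)"
      using x unfolding weight_powr[OF d_pos[OF x]] by (simp add: W_def d_eq)
    finally show ?thesis .
  qed
  have Q_nonneg: "Q x \<ge> 0" for x
    by (simp add: Q_def weight_def)
  \<comment> \<open>the main part of the gradient is separated from the errors of the cutoffs by \<open>powr_add_le\<close>\<close>
  have N_le: "N x \<le> (1 + \<eta>) powr p * \<alpha> powr p * Q x + (1 + 1 / \<eta>) powr p * (M / real n) powr p * L * W x" for x
  proof (cases "x \<in> collar n")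
    case x: True
    have w_pos: "weight \<delta> \<delta>' (d x) \<ge> 0"
      by (simp add: weight_def)
    have W_eq: "W x = d x powr (- real codim)"
      using x by (simp add: W_def d_eq)
    have "grad_norm \<phi> x \<le> d x powr (- \<alpha> - 1) * (\<alpha> * cutoff n x + M / real n)"
      using norm_trial_gradient_le[OF x n(1)] \<alpha>(1) \<phi>C(2) by (simp add: grad_norm_eq M_def d_def)
    then have "grad_norm \<phi> x powr p \<le> (d x powr (- \<alpha> - 1) * (\<alpha> * cutoff n x + M / real n)) powr p"
      using p by (intro powr_mono2) (auto simp: grad_norm_eq)
    also have "\<dots> = d x powr (- p * (\<alpha> + 1)) * (\<alpha> * cutoff n x + M / real n) powr p"
    proof -
      have "(- \<alpha> - 1) * p = - p * (\<alpha> + 1)"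
        by (simp add: algebra_simps)
      then show ?thesis
        by (simp only: powr_mult powr_powr)
    qed
    also have "\<dots> \<le> d x powr (- p * (\<alpha> + 1)) *
        ((1 + \<eta>) powr p * (\<alpha> * cutoff n x) powr p + (1 + 1 / \<eta>) powr p * (M / real n) powr p)"
      using \<alpha>(1) M cutoff_nonneg[of n x] \<eta>(1) p by (intro mult_left_mono powr_add_le) auto
    finally have "N x \<le> weight \<delta> \<delta>' (d x) * (d x powr (- p * (\<alpha> + 1)) *
        ((1 + \<eta>) powr p * (\<alpha> * cutoff n x) powr p + (1 + 1 / \<eta>) powr p * (M / real n) powr p))"
      unfolding N_def by (rule mult_left_mono) (rule w_pos)
    also have "\<dots> = (weight \<delta> \<delta>' (d x) * d x powr (- p * (\<alpha> + 1))) *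
        ((1 + \<eta>) powr p * (\<alpha> powr p * cutoff n x powr p) + (1 + 1 / \<eta>) powr p * (M / real n) powr p)"
      using \<alpha>(1) cutoff_nonneg[of n x] by (simp add: powr_mult mult.assoc)
    also have "weight \<delta> \<delta>' (d x) * d x powr (- p * (\<alpha> + 1)) = W x * (1 + d x) powr (\<delta>' - \<delta>)"
      using weight_powr[OF d_pos[OF x]] W_eq by simp
    also have "W x * (1 + d x) powr (\<delta>' - \<delta>) *
        ((1 + \<eta>) powr p * (\<alpha> powr p * cutoff n x powr p) + (1 + 1 / \<eta>) powr p * (M / real n) powr p)
      = (1 + \<eta>) powr p * \<alpha> powr p * Q x
        + (1 + 1 / \<eta>) powr p * (M / real n) powr p * (1 + d x) powr (\<delta>' - \<delta>) * W x"
      unfolding Q_eq[OF x] by (simp add: algebra_simps)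
    also have "(1 + 1 / \<eta>) powr p * (M / real n) powr p * (1 + d x) powr (\<delta>' - \<delta>) * W x
        \<le> (1 + 1 / \<eta>) powr p * (M / real n) powr p * L * W x"
      using L_bounds(1)[of "d x"] d_pos[OF x] d_le[OF x]
      by (intro mult_right_mono mult_left_mono) (auto simp: W_eq)
    finally show ?thesis
      by simp
  next
    case False
    then show ?thesis
      by (simp add: outside)
  qed
  have Q_ge: "2 * real n * v \<le> (\<integral>x. Q x \<partial>lborel)"
    unfolding v_def
  proof (rule integral_ge_shells[OF int_Q Q_nonneg])
    fix x j assume j: "j \<in> {3 * n..<5 * n}" and x: "x \<in> shell (\<rho>\<^sup>2 / 4) j"
    note xc = cutoff_ge_in_middle_shell[OF j x]
    have W_eq: "W x = sqrt (perp_sq x) powr (- real codim)"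
      using xc(1) by (simp add: W_def)
    have "((9/16) * (9/16)) powr p / L * W x = W x * (1 / L) * ((9/16) * (9/16)) powr p"
      by simp
    also have "\<dots> \<le> W x * (1 + d x) powr (\<delta>' - \<delta>) * cutoff n x powr p"
      using L_bounds(2)[of "d x"] d_pos[OF xc(1)] d_le[OF xc(1)] xc(2) p L
      by (intro mult_mono powr_mono2 mult_left_mono) (auto simp: W_eq)
    also have "\<dots> = Q x"
      by (simp add: Q_eq[OF xc(1)])
    finally show "((9/16) * (9/16)) powr p / L * sqrt (perp_sq x) powr (- real codim) \<le> Q x"
      by (simp only: W_eq)
  qed (use L in auto)
  then have Q_pos: "(\<integral>x. Q x \<partial>lborel) > 0"
    using n(1) v by (intro less_le_trans[OF _ Q_ge]) simp
  have "(\<integral>x. N x \<partial>lborel)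
      \<le> (\<integral>x. (1 + \<eta>) powr p * \<alpha> powr p * Q x + (1 + 1 / \<eta>) powr p * (M / real n) powr p * L * W x \<partial>lborel)"
    by (intro integral_mono int_N Bochner_Integration.integrable_add integrable_mult_right int_Q int_W N_le)
  also have "\<dots> = (1 + \<eta>) powr p * \<alpha> powr p * (\<integral>x. Q x \<partial>lborel)
      + (1 + 1 / \<eta>) powr p * (M / real n) powr p * L * (\<integral>x. W x \<partial>lborel)"
    using int_Q int_W by simp
  also have "(1 + 1 / \<eta>) powr p * (M / real n) powr p * L * (\<integral>x. W x \<partial>lborel) \<le> gap * (\<integral>x. Q x \<partial>lborel)"
  proof -
    have "(M / real n) powr p \<le> M powr p / real n"
    proof -
      have "(M / real n) powr p = M powr p / real n powr p"
        using M by (simp add: powr_divide)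
      also have "\<dots> \<le> M powr p / real n"
        using p n(1) powr_mono[of 1 p "real n"] by (intro divide_left_mono) auto
      finally show ?thesis .
    qed
    then have "(1 + 1 / \<eta>) powr p * (M / real n) powr p * L * (\<integral>x. W x \<partial>lborel)
        \<le> (1 + 1 / \<eta>) powr p * (M powr p / real n) * L * (5 * real n * V)"
      using W_le L by (intro mult_mono mult_left_mono mult_nonneg_nonneg integral_nonneg_AE) (auto simp: W_def)
    also have "\<dots> = B"
      using n(1) by (simp add: B_def)
    also have "\<dots> \<le> gap * (2 * real n * v)"
      using n by (simp add: field_simps)
    also have "\<dots> \<le> gap * (\<integral>x. Q x \<partial>lborel)"
      using gap Q_ge by (intro mult_left_mono) auto
    finally show ?thesis .
  qed
  finally have "(\<integral>x. N x \<partial>lborel) \<le> c * (\<integral>x. Q x \<partial>lborel)"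
    by (simp add: gap_def algebra_simps)
  with Q_pos \<phi>C(1) show ?thesis
    using that[of \<phi>] by (simp add: N_def Q_def d_def)
qed

end

section \<open>The optimal constant\<close>

context convex_in_flat
begin

text \<open>Both integrands vanish on \<open>K\<close>, because \<open>weight \<delta> \<delta>' 0 = 0\<close> (even for \<open>\<delta> = 0\<close>, as
  \<open>0 powr 0 = 0\<close>), so the integrals may be extended to the whole space.\<close>

lemma hardy_constant_complement:
  "hardy_constant p (weight \<delta> \<delta>') (- K) =
     (INF \<phi> \<in> {\<phi> \<in> C1_compact_support (- K). \<phi> \<noteq> (\<lambda>x. 0)}.
        (\<integral>x. weight \<delta> \<delta>' (infdist x K) * grad_norm \<phi> x powr p \<partial>lborel) /
        (\<integral>x. weight \<delta> \<delta>' (infdist x K) * infdist x K powr (- p) * \<bar>\<phi> x\<bar> powr p \<partial>lborel))"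
proof -
  have drop: "indicator (- K) x * (weight \<delta> \<delta>' (infdist x K) * t) = weight \<delta> \<delta>' (infdist x K) * t" for x t
    by (cases "x \<in> K") (simp_all add: weight_def)
  show ?thesis
    unfolding hardy_constant_def set_lebesgue_integral_def bdist_def real_scaleR_def
    by (simp only: mult.assoc drop double_complement)
qed

lemma denominator_eq_kernel:
  "weight \<delta> \<delta>' (infdist x K) * infdist x K powr (- p) * \<bar>\<phi> x\<bar> powr p
    = hardy_kernel \<delta> \<delta>' p ((infdist x K)\<^sup>2) * \<bar>\<phi> x\<bar> powr p"
proof (cases "x \<in> K")
  case True
  then show ?thesis
    by (simp add: weight_def hardy_kernel_def)
next
  case False
  then show ?thesis
    by (simp add: hardy_kernel_square[OF infdist_pos])
qed

lemma numerator_eq_kernel: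
  "weight \<delta> \<delta>' (infdist x K) * grad_norm \<phi> x powr p
    = hardy_kernel \<delta> \<delta>' p ((infdist x K)\<^sup>2) * (infdist x K * norm (gradient \<phi> x)) powr p"
proof (cases "x \<in> K")
  case True
  then show ?thesis
    by (simp add: weight_def hardy_kernel_def)
next
  case False
  then have d: "infdist x K > 0"
    by (rule infdist_pos)
  then have "infdist x K powr (- p) * infdist x K powr p = 1"
    by (simp flip: powr_add)
  then show ?thesis
    using d by (simp add: hardy_kernel_square grad_norm_eq powr_mult)
qed

end

theorem theorem4p2:
  fixes K \<Omega> :: "'a::euclidean_space set" and d d\<^sub>H \<delta> \<delta>' p :: real
  assumes "closed K" and "convex K"
    and "d = real DIM('a)"
    and "aff_dim K \<in> {1..int DIM('a) - 1}"
    and "\<Omega> = - K"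
    and "d\<^sub>H = real_of_int (aff_dim K)"
    and "\<delta> \<ge> 0" and "\<delta>' \<ge> 0" and "p \<ge> 1"
    and "d - d\<^sub>H + min \<delta> \<delta>' - p > 0"
  shows "hausdorff_dim (frontier \<Omega>) = d\<^sub>H \<and>
         hardy_constant p (weight \<delta> \<delta>') \<Omega> \<le> ((d - d\<^sub>H + \<delta> - p) / p) powr p \<and>
         (\<delta> \<le> \<delta>' \<longrightarrow>
           hardy_constant p (weight \<delta> \<delta>') \<Omega> = ((d - d\<^sub>H + \<delta> - p) / p) powr p)"
proof -
  note closed = assms(1) and convex = assms(2) and d = assms(3) and dimK = assms(4)
    and \<Omega> = assms(5) and d\<^sub>H = assms(6) and p = assms(9) and gap = assms(10)
  obtain k where k: "aff_dim K = int k"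
    using dimK by (metis atLeastAtMost_iff int_one_le_iff_zero_less less_imp_le zero_le_imp_eq_int)
  obtain f S y \<rho> where "convex_in_flat K f S y \<rho>" and S: "card S = k"
    using convex_in_flat_exists[OF closed convex k] by blast
  then interpret convex_in_flat K f S y \<rho>
    by simp
  have card: "k < DIM('a)" "real codim = real DIM('a) - real k"
    using dimK k S S_Basis card_mono[OF finite_Basis S_Basis]
    by (auto simp: codim_def card_Diff_subset finite_subset[OF S_Basis])
  have codim_pos: "codim > 0"
    using card by linarith
  have codim_eq: "d - d\<^sub>H = real codim"
    using card d d\<^sub>H k by simp
  have pos: "real codim + \<delta> - p > 0"
    using gap codim_eq by linarith
  define \<mu> where "\<mu> = ((real codim + \<delta> - p) / p) powr p"
  define Num where "Num \<phi> = (\<integral>x. weight \<delta> \<delta>' (infdist x K) * grad_norm \<phi> x powr p \<partial>lborel)" for \<phi>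
  define Den where "Den \<phi> = (\<integral>x. weight \<delta> \<delta>' (infdist x K) * infdist x K powr (- p) * \<bar>\<phi> x\<bar> powr p \<partial>lborel)" for \<phi>
  define A where "A = {\<phi> \<in> C1_compact_support (- K). \<phi> \<noteq> (\<lambda>x. 0)}"
  have constant_eq: "hardy_constant p (weight \<delta> \<delta>') \<Omega> = (INF \<phi>\<in>A. Num \<phi> / Den \<phi>)"
    unfolding \<Omega> hardy_constant_complement A_def Num_def Den_def ..
  have "frontier \<Omega> = K"
  proof -
    have "interior K = {}"
      using aff_dim_nonempty_interior[of K] k card(1) by auto
    then show ?thesis
      unfolding \<Omega> frontier_complement using closed by (simp add: frontier_def)
  qed
  then have dim: "hausdorff_dim (frontier \<Omega>) = d\<^sub>H"
    using hausdorff_dim_eq S k d\<^sub>H by simp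
  have "Num \<phi> / Den \<phi> \<ge> 0" for \<phi>
    unfolding Num_def Den_def by (intro divide_nonneg_nonneg integral_nonneg_AE) (auto simp: weight_def)
  then have bdd: "bdd_below ((\<lambda>\<phi>. Num \<phi> / Den \<phi>) ` A)"
    by (intro bdd_belowI2[where m = 0])
  have near: "\<exists>\<phi>\<in>A. Num \<phi> / Den \<phi> \<le> c" if c: "c > \<mu>" for c
  proof -
    obtain \<phi> where \<phi>: "\<phi> \<in> C1_compact_support (- K)" "Den \<phi> > 0" "Num \<phi> \<le> c * Den \<phi>"
      using near_optimal_trial[OF p codim_pos pos c[unfolded \<mu>_def], of \<delta>']
      unfolding Num_def Den_def by blast
    have "\<phi> \<noteq> (\<lambda>x. 0)"
      using \<phi>(2) by (auto simp: Den_def)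
    with \<phi> show ?thesis
      by (auto simp: A_def divide_le_eq)
  qed
  have upper: "(INF \<phi>\<in>A. Num \<phi> / Den \<phi>) \<le> \<mu>"
  proof (rule dense_ge)
    fix c assume "c > \<mu>"
    then obtain \<phi> where "\<phi> \<in> A" "Num \<phi> / Den \<phi> \<le> c"
      using near by blast
    then show "(INF \<phi>\<in>A. Num \<phi> / Den \<phi>) \<le> c"
      using cINF_lower[OF bdd, of \<phi>] by linarith
  qed
  have lower: "\<mu> \<le> (INF \<phi>\<in>A. Num \<phi> / Den \<phi>)" if "\<delta> \<le> \<delta>'"
  proof (rule cINF_greatest)
    show "A \<noteq> {}"
      using near[of "\<mu> + 1"] by auto
    fix \<phi> assume "\<phi> \<in> A"
    then have \<phi>: "\<phi> \<in> C1_compact_support (- K)" "\<phi> \<noteq> (\<lambda>x. 0)"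
      by (simp_all add: A_def)
    have "Den \<phi> > 0"
      unfolding Den_def denominator_eq_kernel by (rule hardy_denominator_pos[OF \<phi> p])
    moreover have "\<mu> * Den \<phi> \<le> Num \<phi>"
      unfolding \<mu>_def Den_def Num_def denominator_eq_kernel numerator_eq_kernel
      by (rule hardy_inequality[OF \<phi>(1) that p pos])
    ultimately show "\<mu> \<le> Num \<phi> / Den \<phi>"
      by (simp add: le_divide_eq)
  qed
  have \<mu>_eq: "((d - d\<^sub>H + \<delta> - p) / p) powr p = \<mu>"
    by (simp add: \<mu>_def codim_eq)
  show ?thesis
    unfolding constant_eq \<mu>_eq using dim upper lower by (auto intro: antisym)
qed

end
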